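(* Consider maintaining leaf pointers on the sliding suffix tree of a window $W$ of an online text. The credit-based method for leaf pointer maintenance requires worst-case $\Theta(|W|)$ time per leaf insertion or deletion, while the primary-leaf-pointer method requires worst-case $O(1)$ time per leaf insertion or deletion.
   Context: The sliding suffix tree is the suffix tree (compacted trie of all suffixes, no terminal symbol) of the current window $W$ of an online text, maintained by Ukkonen's online algorithm for appending symbols and by deleting the leaf of the whole window (or shortening it) and merging edges when the leftmost symbol is removed. A leaf pointer of an internal node points to one of its existing descendant leaves. Credit-based method: each internal node $v$ stores a leaf pointer $\mathrm{lp}(v)$ (start-index of a leaf) and a bit $\mathrm{cred}(v)\in\{0,1\}$. The procedure $\mathrm{Update}(v,k)$ does nothing if $v$ is null; otherwise sets $\mathrm{lp}(v)\gets\max\{\mathrm{lp}(v),k\}$, flips $\mathrm{cred}(v)$, and if it becomes $0$ calls $\mathrm{Update}(\mathrm{parent}(v),\mathrm{lp}(v))$. A newly created internal node gets $\mathrm{lp}$ equal to the start-index of the new leaf created with it and credit $0$; whenever a new leaf $\mathrm{leaf}(k)$ is created with parent $v$ (including the shortened leaf on deletion), $\mathrm{Update}(v,k)$ is called; when a node $w$ with credit $1$ is removed by edge merging, $\mathrm{Update}(\mathrm{parent}(w),\mathrm{lp}(w))$ is called. Primary-leaf-pointer method: each internal node with children has exactly one primary child, the others (and the root) are secondary; each secondary node $x$ stores $\mathrm{PLP}(x)$, the leaf reached from $x$ following primary children; on each leaf insertion or deletion, a constant number of primary flags and $\mathrm{PLP}$ values (located via parent, child and inverse-$\mathrm{PLP}$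 pointers) are updated to restore these invariants. *)

theory Defs
  imports "HOL-Library.Sublist" "HOL-Library.Landau_Symbols" "HOL-Library.Monad_Syntax"
begin

section \<open>Compacted tries and suffix trees\<close>

definition trie_words :: "'a list set \<Rightarrow> 'a list set" where
  "trie_words A = {u. \<exists>w\<in>A. prefix u w}"

definition ctrie_inner :: "'a list set \<Rightarrow> 'a list set" where
  "ctrie_inner A =
     insert [] {u. \<exists>a b. a \<noteq> b \<and> u @ [a] \<in> trie_words A \<and> u @ [b] \<in> trie_words A}"

definition ctrie_leaves :: "'a list set \<Rightarrow> 'a list set" where
  "ctrie_leaves A = {w \<in> A. w \<noteq> [] \<and> \<not> (\<exists>w'\<in>A. strict_prefix w w')}"


section \<open>The sliding suffix tree\<close>

text \<open>
  The whole text read so far is kept, and the window is the suffix of it from position \<open>start\<close>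
  on; start-indices of leaves are absolute text positions.  The suffixes that currently have a
  leaf are those at the positions \<open>start, \<dots>, act - 1\<close>.  The suffix at position \<open>act\<close> is the active
  suffix of Ukkonen's algorithm: after a symbol has been processed completely it is the longest
  suffix of the window that is a prefix of a longer one, and like all shorter suffixes it is
  implicit.  Internal nodes are identified by their path labels (the root is \<open>Inner []\<close>), leaves
  by their start-indices.
\<close>

record 'a sst =
  input :: "'a list"
  start :: nat
  act :: nat

datatype 'a node = Inner "'a list" | Leaf nat

abbreviation root :: "'a node" where "root \<equiv> Inner []"

definition window :: "'a sst \<Rightarrow> 'a list" where
  "window t = drop (start t) (input t)"

definition active_suffix :: "'a sst \<Rightarrow> 'a list" where
  "active_suffix t = drop (act t) (input t)"

definition leaf_words :: "'a sst \<Rightarrow> 'a list set" where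
  "leaf_words t = (\<lambda>j. drop j (input t)) ` {start t..<act t}"

definition nodes :: "'a sst \<Rightarrow> 'a node set" where
  "nodes t = Inner ` ctrie_inner (leaf_words t) \<union> Leaf ` {start t..<act t}"

fun label :: "'a sst \<Rightarrow> 'a node \<Rightarrow> 'a list" where
  "label t (Inner u) = u"
| "label t (Leaf j) = drop j (input t)"

definition parent :: "'a sst \<Rightarrow> 'a node \<Rightarrow> 'a node option" where
  "parent t x =
     (if label t x = [] then None
      else Some (Inner (ARG_MAX length u.
             u \<in> ctrie_inner (leaf_words t) \<and> strict_prefix u (label t x))))"

definition children :: "'a sst \<Rightarrow> 'a node \<Rightarrow> 'a node set" where
  "children t x = {y \<in> nodes t. parent t y = Some x}"

text \<open>
  The order of the children in the child list of a node is left unspecified.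
\<close>

definition child_list :: "'a sst \<Rightarrow> 'a node \<Rightarrow> 'a node list" where
  "child_list t x = (SOME ys. distinct ys \<and> set ys = children t x)"

text \<open>
  A symbol just appended lengthens all leaf edges at no cost.  As long as the active suffix is not
  represented in the tree, Ukkonen's algorithm creates a leaf for it and goes on to the next
  shorter suffix (follows a suffix link).
\<close>

definition pending :: "'a sst \<Rightarrow> bool" where
  "pending t \<longleftrightarrow> act t < length (input t) \<and> active_suffix t \<notin> trie_words (leaf_words t)"

definition append_symbol :: "'a \<Rightarrow> 'a sst \<Rightarrow> 'a sst" where
  "append_symbol c t = t\<lparr>input := input t @ [c]\<rparr>"

definition insert_leaf :: "'a sst \<Rightarrow> 'a sst" where
  "insert_leaf t = t\<lparr>act := Suc (act t)\<rparr>"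

text \<open>
  On deletion of the leftmost symbol, the leaf of the whole window is shortened to a leaf for the
  active suffix if the active point lies strictly inside its edge; otherwise it is removed.
\<close>

definition shortens :: "'a sst \<Rightarrow> bool" where
  "shortens t \<longleftrightarrow> prefix (active_suffix t) (window t) \<and>
     length (label t (the (parent t (Leaf (start t))))) < length (active_suffix t)"

definition shorten_leaf :: "'a sst \<Rightarrow> 'a sst" where
  "shorten_leaf t = t\<lparr>start := Suc (start t), act := Suc (act t)\<rparr>"

definition remove_leaf :: "'a sst \<Rightarrow> 'a sst" where
  "remove_leaf t = t\<lparr>start := Suc (start t)\<rparr>"


section \<open>Programs with unit-cost primitives\<close>

text \<open>
  A leaf pointer maintenance program may read the tree and read and write its own store.  The
  last component of the result is the number of steps.  Everything that accesses the tree or the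
  store goes through the unit-cost primitives below; reaching the \<open>j\<close>-th entry of a child list
  takes \<open>j + 1\<close> steps.
\<close>

type_synonym ('a, 's, 'x) prog = "'a sst \<Rightarrow> 's \<Rightarrow> 'x \<times> 's \<times> nat"

definition ret :: "'x \<Rightarrow> ('a, 's, 'x) prog" where
  "ret x = (\<lambda>t s. (x, s, 0))"

definition bind_prog ::
  "('a, 's, 'x) prog \<Rightarrow> ('x \<Rightarrow> ('a, 's, 'y) prog) \<Rightarrow> ('a, 's, 'y) prog" where
  "bind_prog m f = (\<lambda>t s. case m t s of (x, s', n) \<Rightarrow>
     (case f x t s' of (y, s'', k) \<Rightarrow> (y, s'', n + k)))"

adhoc_overloading Monad_Syntax.bind \<rightleftharpoons> bind_prog

definition read_field :: "('s \<Rightarrow> 'i \<Rightarrow> 'v) \<Rightarrow> 'i \<Rightarrow> ('a, 's, 'v) prog" where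
  "read_field f i = (\<lambda>t s. (f s i, s, 1))"

definition write_field ::
  "((('i \<Rightarrow> 'v) \<Rightarrow> 'i \<Rightarrow> 'v) \<Rightarrow> 's \<Rightarrow> 's) \<Rightarrow> 'i \<Rightarrow> 'v \<Rightarrow> ('a, 's, unit) prog" where
  "write_field upd i v = (\<lambda>t s. ((), upd (\<lambda>f. f(i := v)) s, 1))"

definition get_parent :: "'a node \<Rightarrow> ('a, 's, 'a node option) prog" where
  "get_parent x = (\<lambda>t s. (parent t x, s, 1))"

definition get_child :: "'a node \<Rightarrow> nat \<Rightarrow> ('a, 's, 'a node option) prog" where
  "get_child x j = (\<lambda>t s.
     (if j < length (child_list t x) then Some (child_list t x ! j) else None, s, j + 1))"

lemma bind_prog_cong [fundef_cong]:
  assumes "m t s = m' t s"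
    and "\<And>x s' n. m' t s = (x, s', n) \<Longrightarrow> f x t s' = f' x t s'"
  shows "bind_prog m f t s = bind_prog m' f' t s"
  using assms by (auto simp: bind_prog_def split: prod.splits)

lemma if_prog_cong [fundef_cong]:
  assumes "b = b'" and "b' \<Longrightarrow> m t s = m' t s" and "\<not> b' \<Longrightarrow> k t s = k' t s"
  shows "(if b then m else k) t s = (if b' then m' else k') t s"
  using assms by auto

lemma option_prog_cong [fundef_cong]:
  assumes "v = v'" and "v' = None \<Longrightarrow> m t s = m' t s"
    and "\<And>x. v' = Some x \<Longrightarrow> f x t s = f' x t s"
  shows "case_option m f v t s = case_option m' f' v' t s"
  using assms by (auto split: option.splits)

lemma parent_SomeD:
  assumes "parent t x = Some y"
  shows "\<exists>u. y = Inner u \<and> u \<in> ctrie_inner (leaf_words t) \<and> strict_prefix u (label t x) \<and>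
    (\<forall>u'. u' \<in> ctrie_inner (leaf_words t) \<and> strict_prefix u' (label t x) \<longrightarrow> length u' \<le> length u)"
proof -
  let ?P = "\<lambda>u. u \<in> ctrie_inner (leaf_words t) \<and> strict_prefix u (label t x)"
  from assms have ne: "label t x \<noteq> []" and y: "y = Inner (ARG_MAX length u. ?P u)"
    by (auto simp: parent_def split: if_splits)
  have 1: "?P []" using ne by (auto simp: ctrie_inner_def strict_prefix_def)
  have 2: "\<forall>u. ?P u \<longrightarrow> length u < length (label t x)"
    by (auto simp: prefix_length_less)
  show ?thesis
    using arg_max_nat_lemma[of ?P, OF 1 2] y by blast
qed

lemma length_label_parent:
  "parent t x = Some y \<Longrightarrow> length (label t y) < length (label t x)"
  by (auto dest!: parent_SomeD simp: prefix_length_less)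


section \<open>Leaf pointer maintenance methods\<close>

text \<open>
  A method reacts to three events.
  \<open>on_insert k v new\<close>: \<open>Leaf k\<close> has been created with parent \<open>v\<close>, and \<open>new\<close> says whether \<open>v\<close> was
  created with it by splitting an edge; it runs on the tree after the insertion.
  \<open>on_remove i v merged\<close>: \<open>Leaf i\<close> with parent \<open>v\<close> is removed, and \<open>merged\<close> says whether \<open>v\<close>
  disappears with it by edge merging; it runs on the tree before the removal.
  \<open>on_shorten i k v\<close>: \<open>Leaf i\<close> with parent \<open>v\<close> is shortened to \<open>Leaf k\<close>; it runs on the tree before
  the shortening.
\<close>

record ('a, 's) lp_method =
  init_store :: 's
  on_insert :: "nat \<Rightarrow> 'a node \<Rightarrow> bool \<Rightarrow> ('a, 's, unit) prog"
  on_remove :: "nat \<Rightarrow> 'a node \<Rightarrow> bool \<Rightarrow> ('a, 's, unit) prog"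
  on_shorten :: "nat \<Rightarrow> nat \<Rightarrow> 'a node \<Rightarrow> ('a, 's, unit) prog"

datatype leaf_op = Insertion | Deletion

text \<open>
  \<open>leaf_step M op t s t' s' n\<close>: a leaf insertion or deletion leads from tree \<open>t\<close> and store \<open>s\<close> to
  \<open>t'\<close> and \<open>s'\<close>, and the method spends \<open>n\<close> steps on it.  The time for maintaining the tree itself
  is not counted.
\<close>

fun leaf_step ::
  "('a, 's) lp_method \<Rightarrow> leaf_op \<Rightarrow> 'a sst \<Rightarrow> 's \<Rightarrow> 'a sst \<Rightarrow> 's \<Rightarrow> nat \<Rightarrow> bool" where
  "leaf_step M Insertion t s t' s' n \<longleftrightarrow>
     pending t \<and> t' = insert_leaf t \<and>
     (let v = the (parent t' (Leaf (act t)))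
      in on_insert M (act t) v (v \<notin> nodes t) t' s = ((), s', n))"
| "leaf_step M Deletion t s t' s' n \<longleftrightarrow>
     \<not> pending t \<and> window t \<noteq> [] \<and>
     (let v = the (parent t (Leaf (start t)))
      in if shortens t
         then t' = shorten_leaf t \<and>
              on_shorten M (start t) (act t) v t s = ((), s', n)
         else t' = remove_leaf t \<and>
              on_remove M (start t) v (v \<notin> nodes t') t s = ((), s', n))"

inductive reachable :: "('a, 's) lp_method \<Rightarrow> 'a set \<Rightarrow> 'a sst \<Rightarrow> 's \<Rightarrow> bool"
  for M :: "('a, 's) lp_method" and \<Sigma> :: "'a set" where
  init: "reachable M \<Sigma> \<lparr>input = [], start = 0, act = 0\<rparr> (init_store M)"
| append: "reachable M \<Sigma> t s \<Longrightarrow> \<not> pending t \<Longrightarrow> c \<in> \<Sigma> \<Longrightarrow> reachable M \<Sigma> (append_symbol c t) s"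
| leaf: "reachable M \<Sigma> t s \<Longrightarrow> leaf_step M op t s t' s' n \<Longrightarrow> reachable M \<Sigma> t' s'"

text \<open>
  Adequacy (\<open>reachable_suffix_tree\<close> below): whenever no leaf insertion is pending, the tree is
  the suffix tree of the window.  Deletions never leave a leaf insertion pending.
\<close>

definition sst_ok :: "'a sst \<Rightarrow> bool" where
  "sst_ok t \<longleftrightarrow> start t \<le> act t \<and> act t \<le> length (input t) \<and>
     (\<forall>j\<in>{start t..<act t}. \<forall>m\<ge>start t. m \<noteq> j \<longrightarrow>
        \<not> prefix (drop j (input t)) (drop m (input t)))"

lemma branching_lcp:
  assumes "v \<in> A" "w \<in> A" "\<not> prefix v w" "\<not> prefix w v" "prefix u v" "prefix u w"
  obtains p where "p \<in> ctrie_inner A" "prefix u p" "strict_prefix p v" "prefix p w"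
proof -
  have "parallel v w" using assms(3,4) by (simp add: parallel_def)
  then obtain p b bs c cs where d: "b \<noteq> c" "v = p @ b # bs" "w = p @ c # cs"
    using parallel_decomp by blast
  have "p @ [b] \<in> trie_words A" "p @ [c] \<in> trie_words A"
    using assms(1,2) d by (auto simp: trie_words_def intro: bexI[of _ v] bexI[of _ w])
  then have "p \<in> ctrie_inner A" using d(1) by (auto simp: ctrie_inner_def)
  moreover have "prefix u p"
  proof (rule ccontr)
    assume n: "\<not> prefix u p"
    have "prefix p v" using d by simp
    then have "prefix p u" using n assms(5) prefix_same_cases by blast
    then obtain z where z: "u = p @ z" by (auto simp: prefix_def)
    with n have "z \<noteq> []" by auto
    with z assms(5,6) d show False by (cases z) auto
  qed
  ultimately show ?thesis using that d by (auto simp: strict_prefix_def)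
qed

lemma leaf_step_ok:
  assumes ok: "sst_ok t" and st: "leaf_step M op t s t' s' n"
  shows "sst_ok t' \<and> (op = Deletion \<longrightarrow> \<not> pending t')"
proof (cases op)
  case Insertion
  then have p: "pending t" and t': "t' = insert_leaf t" using st by auto
  let ?T = "input t" and ?k = "act t"
  have k: "?k < length ?T" using p by (simp add: pending_def)
  have np: "\<not> prefix (drop ?k ?T) (drop m ?T)" if "start t \<le> m" "m \<noteq> ?k" for m
  proof (cases "m < ?k")
    case True
    then show ?thesis using p that by (auto simp: pending_def trie_words_def leaf_words_def active_suffix_def)
  next
    case False
    then have "length (drop m ?T) < length (drop ?k ?T)" using that k by auto
    then show ?thesis using prefix_length_le by fastforce
  qed
  show ?thesis using ok k np t' Insertion
    by (auto simp: sst_ok_def insert_leaf_def less_Suc_eq)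
next
  case Deletion
  let ?T = "input t" and ?k = "act t" and ?i = "start t"
  from Deletion st have p: "\<not> pending t" and w: "window t \<noteq> []"
    and t': "t' = (if shortens t then shorten_leaf t else remove_leaf t)"
    by (auto simp: Let_def split: if_splits)
  have bd: "?i \<le> ?k" "?k \<le> length ?T" "?i < length ?T"
    using ok w by (auto simp: sst_ok_def window_def)
  have un: "\<not> prefix (drop j ?T) (drop m ?T)" if "?i \<le> j" "j < ?k" "?i \<le> m" "m \<noteq> j" for j m
    using ok that by (auto simp: sst_ok_def)
  have act: "\<exists>j. ?i \<le> j \<and> j < ?k \<and> prefix (drop ?k ?T) (drop j ?T)" if "?k < length ?T"
    using p that by (auto simp: pending_def trie_words_def leaf_words_def active_suffix_def)
  have ik: "?i < ?k"
  proof (rule ccontr)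
    assume "\<not> ?i < ?k"
    then have "?k = ?i" using bd by simp
    then show False using act bd by auto
  qed
  define v where "v = the (parent t (Leaf ?i))"
  have "drop ?i ?T \<noteq> []" using bd by simp
  then have "parent t (Leaf ?i) = Some v" by (simp add: v_def parent_def)
  from parent_SomeD[OF this] obtain u where u: "v = Inner u" "u \<in> ctrie_inner (leaf_words t)"
      "strict_prefix u (drop ?i ?T)"
    and umax: "\<And>u'. u' \<in> ctrie_inner (leaf_words t) \<Longrightarrow> strict_prefix u' (drop ?i ?T) \<Longrightarrow> length u' \<le> length u"
    by auto
  have sh: "shortens t \<longleftrightarrow> prefix (drop ?k ?T) (drop ?i ?T) \<and> length u < length (drop ?k ?T)"
    using u by (simp add: shortens_def v_def[symmetric] active_suffix_def window_def del: length_drop)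
  show ?thesis
  proof (cases "shortens t")
    case True
    then have pr: "prefix (drop ?k ?T) (drop ?i ?T)" and lu: "length u < length (drop ?k ?T)"
      using sh by auto
    then have kl: "?k < length ?T" by simp
    have np: "\<not> prefix (drop ?k ?T) (drop m ?T)" if m: "Suc ?i \<le> m" "m \<noteq> ?k" for m
    proof (cases "m < ?k")
      case True
      show ?thesis
      proof
        assume "prefix (drop ?k ?T) (drop m ?T)"
        then obtain q where q: "q \<in> ctrie_inner (leaf_words t)" "prefix (drop ?k ?T) q"
            "strict_prefix q (drop ?i ?T)"
          using branching_lcp[of "drop ?i ?T" "leaf_words t" "drop m ?T" "drop ?k ?T"]
            un[of ?i m] un[of m ?i] True m ik pr by (auto simp: leaf_words_def)
        then show False using umax[OF q(1,3)] lu prefix_length_le[OF q(2)] by linarith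
      qed
    next
      case False
      then have "length (drop m ?T) < length (drop ?k ?T)" using m kl by auto
      then show ?thesis using prefix_length_le by fastforce
    qed
    have "prefix (drop (Suc ?k) ?T) (drop (Suc ?i) ?T)"
    proof -
      from pr obtain z where "drop ?i ?T = drop ?k ?T @ z" by (auto simp: prefix_def)
      then have "tl (drop ?i ?T) = tl (drop ?k ?T) @ z" using kl by (simp add: tl_append2)
      then show ?thesis by (simp add: drop_Suc tl_drop)
    qed
    then have "\<not> pending (shorten_leaf t)"
      using ik by (auto simp: pending_def trie_words_def leaf_words_def active_suffix_def shorten_leaf_def)
    then show ?thesis using True t' bd un np kl ik
      by (auto simp: sst_ok_def shorten_leaf_def less_Suc_eq)
  next
    case False
    have "\<exists>j. Suc ?i \<le> j \<and> j < ?k \<and> prefix (drop ?k ?T) (drop j ?T)" if kl: "?k < length ?T"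
    proof -
      obtain j where j: "?i \<le> j" "j < ?k" "prefix (drop ?k ?T) (drop j ?T)" using act kl by blast
      show ?thesis
      proof (cases "j = ?i")
        case True
        then have le: "length (drop ?k ?T) \<le> length u" using False sh j by (auto simp: not_less)
        then have "u \<noteq> []" using kl by auto
        then obtain a b where ab: "a \<noteq> b" "u @ [a] \<in> trie_words (leaf_words t)"
            "u @ [b] \<in> trie_words (leaf_words t)"
          using u(2) by (auto simp: ctrie_inner_def)
        have "\<exists>m. ?i < m \<and> m < ?k \<and> prefix u (drop m ?T)"
        proof -
          obtain m1 m2 where m: "?i \<le> m1" "m1 < ?k" "prefix (u @ [a]) (drop m1 ?T)"
             "?i \<le> m2" "m2 < ?k" "prefix (u @ [b]) (drop m2 ?T)"
            using ab by (auto simp: trie_words_def leaf_words_def)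
          have "m1 \<noteq> m2" using m ab by (auto simp: prefix_def)
          then have "?i < m1 \<or> ?i < m2" using m by linarith
          then show ?thesis using m by (auto dest: append_prefixD)
        qed
        then obtain m where m: "?i < m" "m < ?k" "prefix u (drop m ?T)" by blast
        have "prefix (drop ?k ?T) u"
          using j True u(3) le prefix_length_prefix[of "drop ?k ?T" "drop ?i ?T" u]
          by (auto simp: strict_prefix_def)
        then have "prefix (drop ?k ?T) (drop m ?T)" using m(3) prefix_order.trans by blast
        then show ?thesis using m by (auto intro!: exI[of _ m])
      next
        case False
        then show ?thesis using j by (auto intro!: exI[of _ j])
      qed
    qed
    then have "\<not> pending (remove_leaf t)"
      by (force simp: pending_def trie_words_def leaf_words_def active_suffix_def remove_leaf_def)
    then show ?thesis using False t' bd un ik by (auto simp: sst_ok_def remove_leaf_def)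
  qed
qed

lemma reachable_ok: "reachable M \<Sigma> t s \<Longrightarrow> sst_ok t"
proof (induction rule: reachable.induct)
  case init
  then show ?case by (simp add: sst_ok_def)
next
  case (append t s c)
  let ?T = "input t"
  have "\<not> prefix (drop j (?T @ [c])) (drop m (?T @ [c]))"
    if "start t \<le> j" "j < act t" "start t \<le> m" "m \<noteq> j" for j m
  proof
    assume a: "prefix (drop j (?T @ [c])) (drop m (?T @ [c]))"
    have j: "j < length ?T" "\<not> prefix (drop j ?T) (drop m ?T)"
      using append.IH that by (auto simp: sst_ok_def)
    have m: "m \<le> length ?T"
    proof (rule ccontr)
      assume "\<not> m \<le> length ?T"
      then show False using a j by simp
    qed
    then have "drop j (?T @ [c]) = drop j ?T @ [c]" "drop m (?T @ [c]) = drop m ?T @ [c]"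
      using j by simp_all
    then have "prefix (drop j ?T @ [c]) (drop m ?T @ [c])" using a by argo
    then have "prefix (drop j ?T) (drop m ?T)"
      by (metis append_prefixD butlast_snoc prefix_order.refl prefix_snoc)
    then show False using j by simp
  qed
  moreover have "start t \<le> act t" "act t \<le> Suc (length ?T)"
    using append.IH by (auto simp: sst_ok_def)
  ultimately show ?case
    unfolding sst_ok_def append_symbol_def by (auto simp del: drop_append)
next
  case (leaf t s op t' s' n)
  then show ?case using leaf_step_ok[OF leaf.IH leaf.hyps(2)] by simp
qed

lemma reachable_suffix_tree:
  assumes r: "reachable M \<Sigma> t s" and p: "\<not> pending t"
  shows "ctrie_inner (leaf_words t) = ctrie_inner (set (suffixes (window t)))"
    and "leaf_words t = ctrie_leaves (set (suffixes (window t)))"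
proof -
  let ?T = "input t" and ?k = "act t" and ?i = "start t"
  let ?S = "set (suffixes (window t))"
  have ok: "sst_ok t" using r by (rule reachable_ok)
  have bd: "?i \<le> ?k" "?k \<le> length ?T" using ok by (auto simp: sst_ok_def)
  have S: "?S = {drop m ?T |m. ?i \<le> m}"
  proof -
    have "suffix w (window t) \<longleftrightarrow> (\<exists>m\<ge>?i. w = drop m ?T)" for w
    proof
      assume "suffix w (window t)"
      then obtain d where "w = drop d (window t)" by (metis append_eq_conv_conj suffix_def)
      then show "\<exists>m\<ge>?i. w = drop m ?T" by (auto simp: window_def intro!: exI[of _ "d + ?i"])
    next
      assume "\<exists>m\<ge>?i. w = drop m ?T"
      then obtain m where "?i \<le> m" "w = drop m ?T" by blast
      then have "w = drop (m - ?i) (window t)" by (simp add: window_def)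
      then show "suffix w (window t)" by (simp add: suffix_drop)
    qed
    then show ?thesis by auto
  qed
  have ex: "\<exists>j\<ge>?i. j < ?k \<and> prefix (drop m ?T) (drop j ?T)" if "?i \<le> m" "m < length ?T" for m
    using that
  proof (induction m rule: less_induct)
    case (less m)
    show ?case
    proof (cases "m < ?k")
      case True
      then show ?thesis using less.prems by auto
    next
      case False
      then have "?k < length ?T" using less.prems by simp
      then obtain j where j: "?i \<le> j" "j < ?k" "prefix (drop ?k ?T) (drop j ?T)"
        using p by (auto simp: pending_def trie_words_def leaf_words_def active_suffix_def)
      then obtain z where "drop j ?T = drop ?k ?T @ z" by (auto simp: prefix_def)
      then have "drop (m - ?k) (drop j ?T) =
          drop (m - ?k) (drop ?k ?T) @ drop (m - ?k - length (drop ?k ?T)) z"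
        by (simp only: drop_append)
      then have pr: "prefix (drop m ?T) (drop (m - ?k + j) ?T)" using False by (simp add: prefix_def)
      have lt: "m - ?k + j < m" using False j by simp
      then obtain j' where "?i \<le> j'" "j' < ?k" "prefix (drop (m - ?k + j) ?T) (drop j' ?T)"
        using less.IH[OF lt] less.prems j by auto
      then show ?thesis using pr prefix_order.trans by blast
    qed
  qed
  have sub: "leaf_words t \<subseteq> ?S" by (auto simp: S leaf_words_def)
  have ne: "u \<in> trie_words (leaf_words t) \<longleftrightarrow> u \<in> trie_words ?S" if "u \<noteq> []" for u
  proof
    assume "u \<in> trie_words (leaf_words t)"
    then show "u \<in> trie_words ?S" using sub by (auto simp: trie_words_def)
  next
    assume "u \<in> trie_words ?S"
    then obtain m where m: "?i \<le> m" "prefix u (drop m ?T)" by (auto simp: trie_words_def S)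
    then have "m < length ?T" using that by (cases "m < length ?T") auto
    then obtain j where "?i \<le> j" "j < ?k" "prefix (drop m ?T) (drop j ?T)" using ex m by blast
    then show "u \<in> trie_words (leaf_words t)"
      using m prefix_order.trans by (fastforce simp: trie_words_def leaf_words_def)
  qed
  then show "ctrie_inner (leaf_words t) = ctrie_inner ?S" by (simp add: ctrie_inner_def)
  show "leaf_words t = ctrie_leaves ?S"
  proof (intro equalityI subsetI)
    fix w assume "w \<in> leaf_words t"
    then obtain j where j: "?i \<le> j" "j < ?k" "w = drop j ?T" by (auto simp: leaf_words_def)
    then have "w \<noteq> []" using bd by auto
    moreover have "\<not> strict_prefix w (drop m ?T)" if "?i \<le> m" for m
      using ok j that by (cases "m = j") (auto simp: sst_ok_def strict_prefix_def)
    ultimately show "w \<in> ctrie_leaves ?S" using j by (auto simp: ctrie_leaves_def S)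
  next
    fix w assume w: "w \<in> ctrie_leaves ?S"
    then obtain m where m: "?i \<le> m" "w = drop m ?T" "w \<noteq> []" by (auto simp: ctrie_leaves_def S)
    then obtain j where j: "?i \<le> j" "j < ?k" "prefix w (drop j ?T)" using ex[of m] by auto
    have "drop j ?T \<in> ?S" using j by (auto simp: S)
    then have "w = drop j ?T" using w j by (auto simp: ctrie_leaves_def strict_prefix_def)
    then show "w \<in> leaf_words t" using j by (auto simp: leaf_words_def)
  qed
qed

text \<open>
  All running times of single leaf operations of the given kinds that can occur, over texts with
  symbols from \<open>\<Sigma>\<close>, while the window has length \<open>w\<close> (on insertion including the symbol being
  appended, on deletion including the symbol being deleted).
\<close>

definition op_times :: "('a, 's) lp_method \<Rightarrow> 'a set \<Rightarrow> leaf_op set \<Rightarrow> nat \<Rightarrow> nat set" where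
  "op_times M \<Sigma> ops w =
     {n. \<exists>t s op t' s'. reachable M \<Sigma> t s \<and> length (window t) = w \<and> op \<in> ops \<and>
                        leaf_step M op t s t' s' n}"

text \<open>
  Meaningful only together with boundedness of \<open>op_times M \<Sigma> ops w\<close>.
\<close>

definition worst_time :: "('a, 's) lp_method \<Rightarrow> 'a set \<Rightarrow> leaf_op set \<Rightarrow> nat \<Rightarrow> nat" where
  "worst_time M \<Sigma> ops w = Sup (op_times M \<Sigma> ops w)"


subsection \<open>The credit-based method\<close>

text \<open>
  The credit bit is a Boolean, \<open>True\<close> standing for 1.
\<close>

record 'a credit_store =
  lp :: "'a node \<Rightarrow> nat"
  cred :: "'a node \<Rightarrow> bool"

function update :: "'a node option \<Rightarrow> nat \<Rightarrow> ('a, 'a credit_store, unit) prog" where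
  "update v k t s =
     (case v of
        None \<Rightarrow> ret ()
      | Some x \<Rightarrow> do {
          l \<leftarrow> read_field lp x;
          write_field lp_update x (max l k);
          c \<leftarrow> read_field cred x;
          write_field cred_update x (\<not> c);
          if c then do {
            p \<leftarrow> get_parent x;
            l' \<leftarrow> read_field lp x;
            update p l'
          } else ret ()
        }) t s"
  by pat_completeness auto
termination
  by (relation "measure (\<lambda>(v, k, t, s). case v of None \<Rightarrow> 0 | Some x \<Rightarrow> Suc (length (label t x)))")
    (auto simp: get_parent_def dest: length_label_parent split: option.splits)

declare update.simps [simp del]

definition credit_insert :: "nat \<Rightarrow> 'a node \<Rightarrow> bool \<Rightarrow> ('a, 'a credit_store, unit) prog" where
  "credit_insert k v new = do {
     (if new then do {
       write_field lp_update v k;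
       write_field cred_update v False
     } else ret ());
     update (Some v) k
   }"

definition credit_remove :: "nat \<Rightarrow> 'a node \<Rightarrow> bool \<Rightarrow> ('a, 'a credit_store, unit) prog" where
  "credit_remove i v merged =
     (if merged then do {
        c \<leftarrow> read_field cred v;
        if c then do {
          p \<leftarrow> get_parent v;
          l \<leftarrow> read_field lp v;
          update p l
        } else ret ()
      } else ret ())"

definition credit_shorten :: "nat \<Rightarrow> nat \<Rightarrow> 'a node \<Rightarrow> ('a, 'a credit_store, unit) prog" where
  "credit_shorten i k v = update (Some v) k"

definition credit_method :: "('a, 'a credit_store) lp_method" where
  "credit_method =
     \<lparr>init_store = \<lparr>lp = (\<lambda>_. 0), cred = (\<lambda>_. False)\<rparr>,
      on_insert = credit_insert,
      on_remove = credit_remove,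
      on_shorten = credit_shorten\<rparr>"


subsection \<open>The primary-leaf-pointer method\<close>

text \<open>
  \<open>prim\<close> marks the primary nodes, \<open>plp\<close> is \<open>PLP\<close> (as a start-index), and \<open>inv_plp\<close> takes the
  start-index of a leaf to the unique secondary node whose \<open>PLP\<close> it is.  Entries of \<open>plp\<close> at
  primary nodes and all entries for nodes no longer in the tree are meaningless.
\<close>

record 'a plp_store =
  prim :: "'a node \<Rightarrow> bool"
  plp :: "'a node \<Rightarrow> nat"
  inv_plp :: "nat \<Rightarrow> 'a node"

definition set_plp :: "'a node \<Rightarrow> nat \<Rightarrow> ('a, 'a plp_store, unit) prog" where
  "set_plp x k = do {
     write_field plp_update x k;
     write_field inv_plp_update k x
   }"

definition other_child :: "'a node \<Rightarrow> 'a node \<Rightarrow> ('a, 's, 'a node option) prog" where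
  "other_child v x = do {
     y \<leftarrow> get_child v 0;
     if y = Some x then get_child v 1 else ret y
   }"

text \<open>
  A node \<open>y\<close> takes over the role of \<open>x\<close> in the partition into primary paths.
\<close>

definition inherit :: "'a node \<Rightarrow> 'a node \<Rightarrow> ('a, 'a plp_store, unit) prog" where
  "inherit x y = do {
     p \<leftarrow> read_field prim x;
     write_field prim_update y p;
     if p then ret ()
     else do {
       l \<leftarrow> read_field plp x;
       set_plp y l
     }
   }"

text \<open>
  If an edge is split, the new internal node takes over the role of its old child, which becomes
  its primary child.  The new leaf is secondary unless it is an only child, which happens when the
  first leaf is attached to the root.
\<close>

definition plp_insert :: "nat \<Rightarrow> 'a node \<Rightarrow> bool \<Rightarrow> ('a, 'a plp_store, unit) prog" where
  "plp_insert k v new = do {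
     w \<leftarrow> other_child v (Leaf k);
     case w of
       None \<Rightarrow> do {
         write_field prim_update (Leaf k) True;
         set_plp v k
       }
     | Some y \<Rightarrow> do {
         (if new then do {
           inherit y v;
           write_field prim_update y True
         } else ret ());
         write_field prim_update (Leaf k) False;
         set_plp (Leaf k) k
       }
   }"

text \<open>
  If the removed leaf is primary, another child of its parent becomes primary instead, and the
  secondary node at the top of the primary path of the removed leaf gets the \<open>PLP\<close> of that
  child.  If the parent disappears by edge merging, its only remaining child takes over its role.
\<close>

definition plp_remove :: "nat \<Rightarrow> 'a node \<Rightarrow> bool \<Rightarrow> ('a, 'a plp_store, unit) prog" where
  "plp_remove i v merged = do {
     w \<leftarrow> other_child v (Leaf i);
     case w of
       None \<Rightarrow> ret ()
     | Some y \<Rightarrow> do {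
         p \<leftarrow> read_field prim (Leaf i);
         (if p then do {
           l \<leftarrow> read_field plp y;
           write_field prim_update y True;
           x \<leftarrow> read_field inv_plp i;
           set_plp x l
         } else ret ());
         if merged then inherit v y else ret ()
       }
   }"

definition plp_shorten :: "nat \<Rightarrow> nat \<Rightarrow> 'a node \<Rightarrow> ('a, 'a plp_store, unit) prog" where
  "plp_shorten i k v = do {
     p \<leftarrow> read_field prim (Leaf i);
     write_field prim_update (Leaf k) p;
     if p then do {
       x \<leftarrow> read_field inv_plp i;
       set_plp x k
     } else set_plp (Leaf k) k
   }"

definition plp_method :: "('a, 'a plp_store) lp_method" where
  "plp_method =
     \<lparr>init_store = \<lparr>prim = (\<lambda>_. False), plp = (\<lambda>_. 0), inv_plp = (\<lambda>_. root)\<rparr>,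
      on_insert = plp_insert,
      on_remove = plp_remove,
      on_shorten = plp_shorten\<rparr>"

text \<open>
  \<open>primary_leaf t s x j\<close>: following primary children from \<open>x\<close> leads to \<open>Leaf j\<close>.
\<close>

inductive primary_leaf :: "'a sst \<Rightarrow> 'a plp_store \<Rightarrow> 'a node \<Rightarrow> nat \<Rightarrow> bool"
  for t :: "'a sst" and s :: "'a plp_store" where
  leaf: "primary_leaf t s (Leaf j) j"
| step: "y \<in> children t x \<Longrightarrow> prim s y \<Longrightarrow> primary_leaf t s y j \<Longrightarrow> primary_leaf t s x j"

text \<open>
  The root of the tree of the empty window has no children, hence no \<open>PLP\<close>.
\<close>

definition plp_invariant :: "'a sst \<Rightarrow> 'a plp_store \<Rightarrow> bool" where
  "plp_invariant t s \<longleftrightarrow>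
     \<not> prim s root \<and>
     (\<forall>x\<in>nodes t. children t x \<noteq> {} \<longrightarrow> (\<exists>!y. y \<in> children t x \<and> prim s y)) \<and>
     (\<forall>x\<in>nodes t. \<not> prim s x \<and> (x \<noteq> root \<or> children t root \<noteq> {}) \<longrightarrow>
        primary_leaf t s x (plp s x) \<and> inv_plp s (plp s x) = x)"

end

theory Submission
  imports Defs
begin

text \<open>
  When a leaf word \<open>w\<close> is added to a compacted trie, the only possibly new inner node is the longest
  prefix \<open>p\<close> of \<open>w\<close> present before.  So a leaf insertion is an edge split, if \<open>p\<close> is new, followed
  by attaching a leaf; a removal is the reverse, and a shortening just renames a leaf.  Each of
  these elementary steps, together with its part of the program, preserves the partition of the
  tree into primary paths.

  An update of the credit-based method climbs the tree, hence takes time linear in the depth.  This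
  is attained in the window \<open>a\<^sup>m b\<close>: every inner node \<open>a\<^sup>i\<close> with \<open>0 < i < m\<close> is there created by its
  first update, which leaves its credit at 1.  Deleting the first symbol merges \<open>a\<^sup>m\<^sup>-\<^sup>1\<close> away, and its
  credit cascades to the root; the same cascade is set off by the leaf inserted with the last
  symbol of \<open>a\<^sup>m b a\<^sup>j c\<close> with \<open>j < m\<close>.
\<close>

section \<open>Growing a compacted trie by one word\<close>

text \<open>Everything about the shape of the tree rests on \<open>sst_ok\<close>: no leaf word is a
  prefix of another suffix of the window. Hence an added word neither lies in the old trie nor
  extends an old word, and its branch point, if not the root, has an old continuation different from
  the new one. Constant time for primary pointers comes from the fact that each elementary step
  changes the \<open>plp\<close> entry of at most one node, which is either next to the affected
  leaf or found in one step by \<open>inv_plp\<close>. No step has to climb. For the credits in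
  \<open>a^m b\<close>, the order of creation matters: leaves are inserted from left to right, so
  the nodes \<open>a^i\<close> arise from the deepest to the shallowest. The update that follows the
  creation of a node stops at that node, and so never spends the credits already stored deeper. In
  this way \<open>m - 1\<close> credits pile up on one path.\<close>

lemma trie_words_insert: "trie_words (insert w A) = {u. prefix u w} \<union> trie_words A"
  by (auto simp: trie_words_def)

lemma trie_words_prefix: "u \<in> trie_words A \<Longrightarrow> prefix v u \<Longrightarrow> v \<in> trie_words A"
  by (auto simp: trie_words_def intro: prefix_order.trans)

lemma Nil_in_ctrie_inner [simp]: "[] \<in> ctrie_inner A"
  by (simp add: ctrie_inner_def)

lemma ctrie_inner_mono: "A \<subseteq> B \<Longrightarrow> ctrie_inner A \<subseteq> ctrie_inner B"
  by (fastforce simp: ctrie_inner_def trie_words_def)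

lemma ctrie_inner_strict_prefix:
  assumes "u \<in> ctrie_inner A" "u \<noteq> []"
  shows "\<exists>w\<in>A. strict_prefix u w"
proof -
  from assms obtain a where "u @ [a] \<in> trie_words A"
    by (auto simp: ctrie_inner_def)
  then obtain w where "w \<in> A" "prefix (u @ [a]) w"
    by (auto simp: trie_words_def)
  then show ?thesis
    by (auto simp: prefix_def strict_prefix_def intro!: bexI[of _ w])
qed

lemma ctrie_inner_subset_trie_words: "ctrie_inner A \<subseteq> insert [] (trie_words A)"
  by (auto simp: trie_words_def strict_prefix_def dest!: ctrie_inner_strict_prefix)

lemma finite_ctrie_inner:
  assumes "finite A"
  shows "finite (ctrie_inner A)"
proof -
  have "trie_words A = (\<Union>w\<in>A. set (prefixes w))"
    by (auto simp: trie_words_def)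
  then have "finite (trie_words A)"
    using assms by simp
  then show ?thesis
    by (intro finite_subset[OF ctrie_inner_subset_trie_words]) simp
qed

text \<open>\<open>[]\<close> is added because the root exists even in the empty trie, where
  \<open>trie_words {}\<close> is empty. Greatest in the prefix order is the same as longest, since
  the prefixes of \<open>w\<close> form a chain.\<close>

definition branch_point :: "'a list set \<Rightarrow> 'a list \<Rightarrow> 'a list \<Rightarrow> bool" where
  "branch_point A w p \<longleftrightarrow> p \<in> insert [] (trie_words A) \<and> prefix p w \<and>
     (\<forall>u \<in> insert [] (trie_words A). prefix u w \<longrightarrow> prefix u p)"

lemma ex_branch_point: "\<exists>p. branch_point A w p"
proof -
  let ?P = "\<lambda>u. u \<in> insert [] (trie_words A) \<and> prefix u w"
  have "?P []" by simp
  moreover have "\<forall>u. ?P u \<longrightarrow> length u < Suc (length w)"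
    by (auto dest: prefix_length_le)
  ultimately obtain p where "?P p" and max: "\<forall>u. ?P u \<longrightarrow> length u \<le> length p"
    using ex_has_greatest_nat[of ?P "[]" length "Suc (length w)"] by blast
  then have "prefix u p" if "?P u" for u
    using that by (meson prefix_length_prefix)
  then show ?thesis
    using \<open>?P p\<close> by (auto simp: branch_point_def)
qed

lemma branch_point_strict_prefix:
  assumes "branch_point A w p" "w \<noteq> []" "w \<notin> trie_words A"
  shows "strict_prefix p w"
  using assms by (auto simp: branch_point_def strict_prefix_def)

text \<open>A node that newly branches has one continuation that occurs only in \<open>w\<close>, so
  it is where \<open>w\<close> leaves the old trie. Conversely, an old word through a nonempty
  \<open>p\<close> cannot end there, as it would be a prefix of \<open>w\<close>; its next symbol
  differs from that of \<open>w\<close> because \<open>p\<close> is maximal.\<close>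

lemma ctrie_inner_insert:
  assumes bp: "branch_point A w p"
    and w: "w \<noteq> []" "w \<notin> trie_words A" and np: "\<And>v. v \<in> A \<Longrightarrow> \<not> prefix v w"
  shows "ctrie_inner (insert w A) = insert p (ctrie_inner A)"
proof (intro equalityI subsetI)
  fix u assume "u \<in> ctrie_inner (insert w A)"
  then consider "u = []" | a b where "a \<noteq> b"
      "u @ [a] \<in> trie_words (insert w A)" "u @ [b] \<in> trie_words (insert w A)"
    by (auto simp: ctrie_inner_def)
  then show "u \<in> insert p (ctrie_inner A)"
  proof cases
    case 1
    then show ?thesis by simp
  next
    case 2
    have same: "a = b" if "prefix (u @ [a]) w" "prefix (u @ [b]) w"
      using that by (auto simp: prefix_def)
    \<comment> \<open>The symbol \<open>x\<close> after \<open>u\<close> comes from \<open>w\<close>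
      alone while \<open>u\<close> itself is old, so \<open>w\<close> leaves the old trie right
      after \<open>u\<close>.\<close>
    have eq: "u = p" if x: "prefix (u @ [x]) w" "u @ [x] \<notin> trie_words A" and "u @ [y] \<in> trie_words A" for x y
    proof -
      have "prefix u w" using x by (auto dest: append_prefixD)
      moreover have "u \<in> trie_words A"
        using that(3) by (rule trie_words_prefix) simp
      ultimately have "prefix u p" using bp by (auto simp: branch_point_def)
      moreover have "\<not> strict_prefix u p"
      proof
        assume "strict_prefix u p"
        moreover have "prefix p w" using bp by (simp add: branch_point_def)
        ultimately have "prefix (u @ [x]) p"
          using x(1) prefix_length_prefix[of "u @ [x]" w p] prefix_length_less by fastforce
        moreover have "p \<in> trie_words A"
          using bp \<open>strict_prefix u p\<close> by (auto simp: branch_point_def)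
        ultimately show False using x(2) trie_words_prefix by blast
      qed
      ultimately show "u = p" by (simp add: strict_prefix_def)
    qed
    show ?thesis
      using 2 same eq[of a b] eq[of b a] by (auto simp: trie_words_insert ctrie_inner_def)
  qed
next
  fix u assume u: "u \<in> insert p (ctrie_inner A)"
  have "p \<in> ctrie_inner (insert w A)"
  proof (cases "p = []")
    case False
    then obtain v where v: "v \<in> A" "prefix p v"
      using bp by (auto simp: branch_point_def trie_words_def)
    have pw: "strict_prefix p w" using bp w by (rule branch_point_strict_prefix)
    have "p \<noteq> v" using pw np[OF v(1)] by (auto simp: strict_prefix_def)
    then obtain b zs where b: "v = p @ b # zs"
      using v(2) by (metis append_Nil2 list.exhaust prefix_def)
    from pw obtain a ys where a: "w = p @ a # ys"
      by (rule strict_prefixE')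
    have pb: "p @ [b] \<in> trie_words A"
      using v(1) b by (auto simp: trie_words_def intro!: bexI[of _ v])
    have "a \<noteq> b"
    proof
      assume "a = b"
      then have "prefix (p @ [b]) p"
        using bp pb a by (auto simp: branch_point_def)
      then show False by (auto dest: prefix_length_le)
    qed
    moreover have "p @ [a] \<in> trie_words (insert w A)"
      using a by (auto simp: trie_words_insert)
    ultimately show ?thesis
      using pb by (auto simp: ctrie_inner_def trie_words_insert)
  qed simp
  then show "u \<in> ctrie_inner (insert w A)"
    using u ctrie_inner_mono[of A "insert w A"] by auto
qed

text \<open>This makes \<open>p\<close> the parent of the new leaf in the grown trie.\<close>

lemma branch_point_max:
  assumes "branch_point A w p" "w \<noteq> []" "w \<notin> trie_words A" "\<And>v. v \<in> A \<Longrightarrow> \<not> prefix v w"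
    and "u \<in> ctrie_inner (insert w A)" "prefix u w"
  shows "prefix u p"
  using assms ctrie_inner_insert[OF assms(1-4)] ctrie_inner_subset_trie_words[of A]
  by (auto simp: branch_point_def)


section \<open>The shape of the sliding suffix tree\<close>

text \<open>Prefixes of one word form a chain, so the longest one is also the greatest in the prefix
  order. This characterization and its converse \<open>parent_SomeE\<close> replace the
  \<open>ARG_MAX\<close> of the definition from here on.\<close>

lemma parent_eqI:
  assumes "u \<in> ctrie_inner (leaf_words t)" "strict_prefix u (label t x)"
    and "\<And>v. v \<in> ctrie_inner (leaf_words t) \<Longrightarrow> strict_prefix v (label t x) \<Longrightarrow> prefix v u"
  shows "parent t x = Some (Inner u)"
proof -
  have "label t x \<noteq> []" using assms(2) by auto
  then obtain y where y: "parent t x = Some y" by (simp add: parent_def)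
  from parent_SomeD[OF y] obtain v where v: "y = Inner v" "v \<in> ctrie_inner (leaf_words t)"
    "strict_prefix v (label t x)" and le: "length u \<le> length v"
    using assms(1,2) by blast
  have "prefix v u" using assms(3) v by blast
  then have "v = u" using le by (auto simp: prefix_def)
  then show ?thesis using y v by simp
qed

lemma parent_SomeE:
  assumes "parent t x = Some y"
  obtains u where "y = Inner u" "u \<in> ctrie_inner (leaf_words t)" "strict_prefix u (label t x)"
    "\<And>v. v \<in> ctrie_inner (leaf_words t) \<Longrightarrow> strict_prefix v (label t x) \<Longrightarrow> prefix v u"
proof -
  from parent_SomeD[OF assms] obtain u where u: "y = Inner u" "u \<in> ctrie_inner (leaf_words t)"
    "strict_prefix u (label t x)" and
    le: "\<forall>v. v \<in> ctrie_inner (leaf_words t) \<and> strict_prefix v (label t x) \<longrightarrow> length v \<le> length u"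
    by blast
  have "prefix v u" if "v \<in> ctrie_inner (leaf_words t)" "strict_prefix v (label t x)" for v
    using that le u(3) by (meson prefix_length_prefix prefix_order.less_imp_le)
  then show ?thesis using that u by blast
qed

lemma parent_snoc:
  assumes "label t x = u @ [c]" "u \<in> ctrie_inner (leaf_words t)"
  shows "parent t x = Some (Inner u)"
  using assms by (intro parent_eqI) (auto simp: strict_prefix_def)

lemma parent_Inner_snoc:
  "u \<in> ctrie_inner (leaf_words t) \<Longrightarrow> parent t (Inner (u @ [c])) = Some (Inner u)"
  by (rule parent_snoc) simp_all

lemma parent_cong:
  assumes "label t x = label t' x"
    and "\<And>u. strict_prefix u (label t x) \<Longrightarrow>
           u \<in> ctrie_inner (leaf_words t) \<longleftrightarrow> u \<in> ctrie_inner (leaf_words t')"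
  shows "parent t x = parent t' x"
proof -
  have "(\<lambda>u. u \<in> ctrie_inner (leaf_words t) \<and> strict_prefix u (label t x)) =
        (\<lambda>u. u \<in> ctrie_inner (leaf_words t') \<and> strict_prefix u (label t' x))"
    using assms by auto
  then show ?thesis using assms(1) by (simp add: parent_def)
qed

lemma parent_root [simp]: "parent t root = None"
  by (simp add: parent_def)

lemma finite_nodes: "finite (nodes t)"
  by (simp add: nodes_def leaf_words_def finite_ctrie_inner)

lemma finite_children: "finite (children t x)"
  using finite_nodes[of t] by (simp add: children_def)

lemma root_in_nodes [simp]: "root \<in> nodes t"
  by (simp add: nodes_def)

lemma Inner_in_nodes: "Inner u \<in> nodes t \<longleftrightarrow> u \<in> ctrie_inner (leaf_words t)"
  by (auto simp: nodes_def)

lemma Leaf_in_nodes: "Leaf j \<in> nodes t \<longleftrightarrow> start t \<le> j \<and> j < act t"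
  by (auto simp: nodes_def)

lemma node_label_in_trie_words:
  assumes "x \<in> nodes t" "label t x \<noteq> []"
  shows "label t x \<in> trie_words (leaf_words t)"
  using assms ctrie_inner_subset_trie_words[of "leaf_words t"]
  by (auto simp: nodes_def trie_words_def leaf_words_def)

lemma leaf_label_maximal:
  assumes "sst_ok t" "Leaf j \<in> nodes t" "u \<in> trie_words (leaf_words t)"
  shows "\<not> strict_prefix (label t (Leaf j)) u"
proof
  assume s: "strict_prefix (label t (Leaf j)) u"
  obtain m where m: "start t \<le> m" "prefix u (drop m (input t))"
    using assms(3) by (auto simp: trie_words_def leaf_words_def)
  then have "prefix (drop j (input t)) (drop m (input t))"
    using s by (auto simp: strict_prefix_def dest: prefix_order.trans)
  then have "m = j"
    using assms(1,2) m by (auto simp: sst_ok_def Leaf_in_nodes)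
  then show False using s m(2) by (auto simp: strict_prefix_def)
qed

lemma leaf_label_nonempty:
  assumes "sst_ok t" "Leaf j \<in> nodes t"
  shows "label t (Leaf j) \<noteq> []"
  using assms by (auto simp: sst_ok_def Leaf_in_nodes)

lemma strict_prefix_label_Inner:
  assumes "sst_ok t" "x \<in> nodes t" "u \<in> trie_words (leaf_words t)" "strict_prefix (label t x) u"
  shows "x = Inner (label t x)" "label t x \<in> ctrie_inner (leaf_words t)"
proof -
  show "x = Inner (label t x)"
    using assms leaf_label_maximal[OF assms(1) _ assms(3)] by (cases x) auto
  then show "label t x \<in> ctrie_inner (leaf_words t)"
    using assms(2) by (metis Inner_in_nodes)
qed

text \<open>A nonempty inner label is a strict prefix of a leaf word, whereas leaf words are maximal
  in the trie.\<close>

lemma leaf_not_inner: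
  assumes ok: "sst_ok t" and x: "Leaf j \<in> nodes t"
  shows "label t (Leaf j) \<notin> ctrie_inner (leaf_words t)"
proof
  assume i: "label t (Leaf j) \<in> ctrie_inner (leaf_words t)"
  obtain w where "w \<in> leaf_words t" "strict_prefix (label t (Leaf j)) w"
    using ctrie_inner_strict_prefix[OF i leaf_label_nonempty[OF ok x]] by blast
  then show False
    using leaf_label_maximal[OF ok x, of w] by (auto simp: trie_words_def)
qed

lemma label_inj:
  assumes ok: "sst_ok t" and "x \<in> nodes t" "y \<in> nodes t" "label t x = label t y"
  shows "x = y"
proof (cases x; cases y)
  fix i j assume xy: "x = Leaf i" "y = Leaf j"
  then have "prefix (drop i (input t)) (drop j (input t))" using assms by simp
  then have "j = i" using ok assms(2,3) xy by (auto simp: sst_ok_def Leaf_in_nodes)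
  then show ?thesis using xy by simp
next
  fix i u assume "x = Leaf i" "y = Inner u"
  then show ?thesis using assms leaf_not_inner[OF ok] by (metis Inner_in_nodes label.simps(1))
next
  fix i u assume "x = Inner u" "y = Leaf i"
  then show ?thesis using assms leaf_not_inner[OF ok] by (metis Inner_in_nodes label.simps(1))
next
  fix u v assume "x = Inner u" "y = Inner v"
  then show ?thesis using assms by simp
qed

text \<open>Take the shortest node label on the path to \<open>w\<close> that is strictly longer
  than \<open>p\<close>: this \<open>y\<close> is the lower end of the edge that contains
  \<open>p\<close> or starts at it. When the edge is split at \<open>p\<close>, \<open>y\<close>
  becomes the old child of the new node.\<close>

lemma ex_node_below:
  assumes w: "w \<in> leaf_words t" "strict_prefix p w"
  obtains y where "y \<in> nodes t" "strict_prefix p (label t y)"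
    "\<And>u. u \<in> ctrie_inner (leaf_words t) \<Longrightarrow> strict_prefix u (label t y) \<Longrightarrow> prefix u p"
proof -
  let ?P = "\<lambda>x. x \<in> nodes t \<and> strict_prefix p (label t x) \<and> prefix (label t x) w"
  obtain j where "?P (Leaf j)"
    using w by (auto simp: leaf_words_def nodes_def)
  then obtain y where y: "?P y" and min: "\<And>x. ?P x \<Longrightarrow> length (label t y) \<le> length (label t x)"
    using ex_has_least_nat[of ?P "Leaf j" "\<lambda>x. length (label t x)"] by blast
  have "prefix u p" if u: "u \<in> ctrie_inner (leaf_words t)" "strict_prefix u (label t y)" for u
  proof (rule ccontr)
    assume n: "\<not> prefix u p"
    have "prefix p (label t y)" "prefix u (label t y)"
      using y u by (auto simp: strict_prefix_def)
    then have "strict_prefix p u"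
      using n prefix_same_cases by (auto simp: strict_prefix_def)
    moreover have "prefix u w"
      using y u by (auto simp: strict_prefix_def dest: prefix_order.trans)
    ultimately have "length (label t y) \<le> length u"
      using min[of "Inner u"] u by (simp add: Inner_in_nodes)
    then show False using u(2) prefix_length_less by fastforce
  qed
  then show ?thesis using that y by blast
qed

lemma ex_child:
  assumes "w \<in> leaf_words t" "strict_prefix p w" "p \<in> ctrie_inner (leaf_words t)"
  shows "children t (Inner p) \<noteq> {}"
proof -
  obtain y where "y \<in> nodes t" "strict_prefix p (label t y)"
    "\<And>u. u \<in> ctrie_inner (leaf_words t) \<Longrightarrow> strict_prefix u (label t y) \<Longrightarrow> prefix u p"
    using ex_node_below[OF assms(1,2)] by blast
  then show ?thesis
    using parent_eqI[OF assms(3)] by (auto simp: children_def)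
qed

text \<open>One relation serves both directions: an insertion grows the tree by
  \<open>k = act t\<close>, and a removal is the growth of the later tree into the earlier one by
  \<open>k = start t\<close>. Hence \<open>k\<close> may lie at either end of the index
  interval.\<close>

definition grows :: "'a sst \<Rightarrow> 'a sst \<Rightarrow> nat \<Rightarrow> bool" where
  "grows t t' k \<longleftrightarrow> sst_ok t \<and> sst_ok t' \<and> input t' = input t \<and> k \<notin> {start t..<act t} \<and>
     {start t'..<act t'} = insert k {start t..<act t}"

lemma label_cong: "input t' = input t \<Longrightarrow> label t' x = label t x"
  by (cases x) auto

text \<open>This turns \<open>sst_ok\<close> into the hypotheses of
  \<open>ctrie_inner_insert\<close>. The remaining indices \<open>J\<close> are kept general because
  \<open>k\<close> is the last index in an insertion and the first in a removal; a shortening uses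
  the same \<open>J\<close> for both trees.\<close>

lemma sst_ok_insert:
  assumes ok: "sst_ok t" and j: "{start t..<act t} = insert k J" "k \<notin> J"
  defines "w \<equiv> drop k (input t)" and "A \<equiv> (\<lambda>j. drop j (input t)) ` J"
  shows "leaf_words t = insert w A" "w \<noteq> []" "w \<notin> trie_words A" "\<And>v. v \<in> A \<Longrightarrow> \<not> prefix v w"
proof -
  show "leaf_words t = insert w A"
    by (auto simp: leaf_words_def j w_def A_def)
  have k: "start t \<le> k" "k < act t" using j by auto
  have J: "start t \<le> i \<and> i < act t \<and> i \<noteq> k" if "i \<in> J" for i
    using j that by (metis atLeastLessThan_iff insertI2)
  show "w \<noteq> []" using k ok by (auto simp: w_def sst_ok_def)
  have np: "\<not> prefix (drop i (input t)) (drop m (input t))"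
    if "start t \<le> i" "i < act t" "start t \<le> m" "m \<noteq> i" for i m
    using ok that by (auto simp: sst_ok_def)
  show "w \<notin> trie_words A"
  proof
    assume "w \<in> trie_words A"
    then obtain i where "i \<in> J" "prefix w (drop i (input t))"
      by (auto simp: trie_words_def A_def)
    then show False using np[of k i] J k by (simp add: w_def)
  qed
  show "\<not> prefix v w" if v: "v \<in> A" for v
  proof -
    obtain i where "i \<in> J" "v = drop i (input t)" using v by (auto simp: A_def)
    then show ?thesis using np[of i k] J[of i] k by (simp add: w_def)
  qed
qed

text \<open>The node \<open>p\<close> is the branch point of the new word. If it is new, it lies
  strictly inside a single old edge from \<open>q\<close> to \<open>y\<close>: all old nodes below
  it are reached through this edge, so only \<open>y\<close> gets another parent.\<close>

lemma grows_tree: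
  assumes g: "grows t t' k"
  obtains p where "parent t' (Leaf k) = Some (Inner p)" "Leaf k \<notin> nodes t"
    "nodes t' = insert (Leaf k) (insert (Inner p) (nodes t))"
    "Inner p \<in> nodes t \<longrightarrow> (\<forall>x\<in>nodes t. parent t' x = parent t x)"
    "Inner p \<notin> nodes t \<longrightarrow> (\<exists>y\<in>nodes t. \<exists>q\<in>nodes t. parent t y = Some q \<and>
       parent t' (Inner p) = Some q \<and> parent t' y = Some (Inner p) \<and>
       (\<forall>x\<in>nodes t. x \<noteq> y \<longrightarrow> parent t' x = parent t x))"
proof -
  let ?w = "drop k (input t)"
  let ?A = "leaf_words t"
  have ok: "sst_ok t" "sst_ok t'" and inp: "input t' = input t"
    and idx: "k \<notin> {start t..<act t}" "{start t'..<act t'} = insert k {start t..<act t}"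
    using g by (auto simp: grows_def)
  have A': "leaf_words t' = insert ?w ?A" and w: "?w \<noteq> []" "?w \<notin> trie_words ?A"
    "\<And>v. v \<in> ?A \<Longrightarrow> \<not> prefix v ?w"
    using sst_ok_insert[OF ok(2) idx(2,1)] by (auto simp: inp leaf_words_def)
  obtain p where bp: "branch_point ?A ?w p" using ex_branch_point by blast
  have I: "ctrie_inner (leaf_words t') = insert p (ctrie_inner ?A)"
    using ctrie_inner_insert[OF bp w] by (simp add: A')
  have pw: "strict_prefix p ?w" using branch_point_strict_prefix[OF bp w(1,2)] .
  have lab: "label t' x = label t x" for x using inp by (rule label_cong)
  have "parent t' (Leaf k) = Some (Inner p)"
    using branch_point_max[OF bp w] A' pw I inp
    by (intro parent_eqI) (auto simp: strict_prefix_def)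
  moreover have "Leaf k \<notin> nodes t" using idx by (auto simp: nodes_def)
  moreover have "nodes t' = insert (Leaf k) (insert (Inner p) (nodes t))"
    unfolding nodes_def I idx by auto
  moreover have "parent t' x = parent t x" if "Inner p \<in> nodes t" for x
    using that by (intro parent_cong) (auto simp: lab I Inner_in_nodes)
  moreover have "\<exists>y\<in>nodes t. \<exists>q\<in>nodes t. parent t y = Some q \<and>
       parent t' (Inner p) = Some q \<and> parent t' y = Some (Inner p) \<and>
       (\<forall>x\<in>nodes t. x \<noteq> y \<longrightarrow> parent t' x = parent t x)" if new: "Inner p \<notin> nodes t"
  proof -
    have pn: "p \<notin> ctrie_inner ?A" using new by (simp add: Inner_in_nodes)
    then have "p \<noteq> []" by auto
    then obtain v where v: "v \<in> ?A" "prefix p v"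
      using bp by (auto simp: branch_point_def trie_words_def)
    have "strict_prefix p v" using v pw w(3)[OF v(1)] by (auto simp: strict_prefix_def)
    then obtain y where y: "y \<in> nodes t" "strict_prefix p (label t y)"
      and ymin: "\<And>u. u \<in> ctrie_inner ?A \<Longrightarrow> strict_prefix u (label t y) \<Longrightarrow> prefix u p"
      using ex_node_below[OF v(1)] by blast
    have ly: "label t y \<noteq> []" using y by auto
    then obtain z where z: "parent t y = Some z" by (simp add: parent_def)
    then obtain q where q: "z = Inner q" "q \<in> ctrie_inner ?A" "strict_prefix q (label t y)"
      and qmax: "\<And>u. u \<in> ctrie_inner ?A \<Longrightarrow> strict_prefix u (label t y) \<Longrightarrow> prefix u q"
      by (rule parent_SomeE) blast
    have "prefix q p" using ymin q by blast
    then have qp: "strict_prefix q p" using q(2) pn by (auto simp: strict_prefix_def)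
    have "parent t' (Inner p) = Some (Inner q)"
    proof (rule parent_eqI)
      fix u assume "u \<in> ctrie_inner (leaf_words t')" "strict_prefix u (label t' (Inner p))"
      then show "prefix u q"
        using y(2) by (intro qmax) (auto simp: I dest: prefix_order.less_trans)
    qed (use qp q in \<open>auto simp: I\<close>)
    moreover have "parent t' y = Some (Inner p)"
      using y ymin by (intro parent_eqI) (auto simp: I lab)
    moreover have "parent t' x = parent t x" if x: "x \<in> nodes t" "x \<noteq> y" for x
    proof (cases "strict_prefix p (label t x)")
      case False
      then show ?thesis by (intro parent_cong) (auto simp: lab I)
    next
      case True
      have tx: "label t x \<in> trie_words ?A"
        using True by (intro node_label_in_trie_words[OF x(1)]) auto
      have ty: "label t y \<in> trie_words ?A"
        using ly by (rule node_label_in_trie_words[OF y(1)])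
      \<comment> \<open>Some old inner node lies strictly between \<open>p\<close> and
        \<open>x\<close>, so \<open>p\<close> does not become the parent of \<open>x\<close>. If
        \<open>x\<close> is below \<open>y\<close>, this node is \<open>y\<close>; if the labels are
        incomparable, it is their longest common prefix, which differs from \<open>p\<close> because
        \<open>p\<close> was not inner. A label of \<open>x\<close> strictly above that of
        \<open>y\<close> would contradict the choice of \<open>y\<close>.\<close>
      have "\<exists>u\<in>ctrie_inner ?A. strict_prefix p u \<and> strict_prefix u (label t x)"
      proof -
        have ne: "label t x \<noteq> label t y" using label_inj[OF ok(1)] x y by blast
        consider "strict_prefix (label t x) (label t y)" | "strict_prefix (label t y) (label t x)"
          | "\<not> prefix (label t x) (label t y)" "\<not> prefix (label t y) (label t x)"
          using ne by (auto simp: strict_prefix_def)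
        then show ?thesis
        proof cases
          case 1
          then have "label t x \<in> ctrie_inner ?A"
            using strict_prefix_label_Inner(2)[OF ok(1) x(1) ty] by blast
          then show ?thesis using ymin 1 True by (meson prefix_order.leD)
        next
          case 2
          then show ?thesis
            using strict_prefix_label_Inner(2)[OF ok(1) y(1) tx] y(2) by blast
        next
          case 3
          obtain c where c: "c \<in> ctrie_inner {label t x, label t y}" "prefix p c"
              "strict_prefix c (label t x)" "prefix c (label t y)"
            using branching_lcp[of "label t x" "{label t x, label t y}" "label t y" p] 3 True y(2)
            by (auto simp: strict_prefix_def)
          have "trie_words {label t x, label t y} \<subseteq> trie_words ?A"
            using tx ty by (auto simp: trie_words_def dest: prefix_order.trans)
          then have "c \<in> ctrie_inner ?A"
            using c(1) by (auto simp: ctrie_inner_def)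
          then show ?thesis
            using c pn by (auto simp: strict_prefix_def)
        qed
      qed
      then obtain u where u: "u \<in> ctrie_inner ?A" "strict_prefix p u" "strict_prefix u (label t x)"
        by blast
      have "label t x \<noteq> []" using True by auto
      then obtain z where "parent t x = Some z" by (simp add: parent_def)
      moreover from this obtain r where r: "z = Inner r" "r \<in> ctrie_inner ?A"
        "strict_prefix r (label t x)"
        "\<And>u. u \<in> ctrie_inner ?A \<Longrightarrow> strict_prefix u (label t x) \<Longrightarrow> prefix u r"
        by (rule parent_SomeE) blast
      moreover have "prefix p r" using r(4)[OF u(1,3)] u(2)
        by (meson prefix_order.le_less_trans prefix_order.less_le_trans prefix_order.less_imp_le)
      ultimately have "parent t' x = Some (Inner r)"
        by (intro parent_eqI) (auto simp: I lab)
      then show ?thesis using r \<open>parent t x = Some z\<close> by simp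
    qed
    moreover have "Inner q \<in> nodes t" using q by (simp add: Inner_in_nodes)
    ultimately show ?thesis
      using y(1) z q(1) by blast
  qed
  ultimately show ?thesis using that by blast
qed


section \<open>Primary paths in rooted trees\<close>

inductive primary_path ::
  "'a node set \<Rightarrow> ('a node \<Rightarrow> 'a node option) \<Rightarrow> ('a node \<Rightarrow> bool) \<Rightarrow> 'a node \<Rightarrow> nat \<Rightarrow> bool"
  for N pa P where
  leaf: "primary_path N pa P (Leaf j) j"
| step: "y \<in> N \<Longrightarrow> pa y = Some x \<Longrightarrow> P y \<Longrightarrow> primary_path N pa P y j \<Longrightarrow> primary_path N pa P x j"

text \<open>Parents are inner nodes, so leaves have no children. The rank excludes cycles without
  reference to labels; for actual trees it is the label length.\<close>

definition rooted_tree :: "'a node set \<Rightarrow> ('a node \<Rightarrow> 'a node option) \<Rightarrow> bool" where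
  "rooted_tree N pa \<longleftrightarrow> root \<in> N \<and> pa root = None \<and>
     (\<forall>x\<in>N. x \<noteq> root \<longrightarrow> (\<exists>u. Inner u \<in> N \<and> pa x = Some (Inner u))) \<and>
     (\<exists>rk :: 'a node \<Rightarrow> nat. \<forall>x\<in>N. \<forall>y. pa x = Some y \<longrightarrow> rk y < rk x)"

text \<open>
  The tree is given by an arbitrary node set and parent function, since the intermediate
  trees of an edge split or merge are not suffix trees: there a node has a single child.
\<close>

definition plp_inv ::
  "'a node set \<Rightarrow> ('a node \<Rightarrow> 'a node option) \<Rightarrow>
   ('a node \<Rightarrow> bool) \<Rightarrow> ('a node \<Rightarrow> nat) \<Rightarrow> (nat \<Rightarrow> 'a node) \<Rightarrow> bool" where
  "plp_inv N pa P L V \<longleftrightarrow> \<not> P root \<and>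
     (\<forall>x\<in>N. (\<exists>y\<in>N. pa y = Some x) \<longrightarrow> (\<exists>!y. y \<in> N \<and> pa y = Some x \<and> P y)) \<and>
     (\<forall>x\<in>N. \<not> P x \<and> (x \<noteq> root \<or> (\<exists>y\<in>N. pa y = Some root)) \<longrightarrow>
        primary_path N pa P x (L x) \<and> V (L x) = x)"

section \<open>Uniqueness and tops of primary paths\<close>

lemma plp_invI:
  assumes "\<not> P root"
    and "\<And>x. x \<in> N \<Longrightarrow> \<exists>y\<in>N. pa y = Some x \<Longrightarrow> \<exists>!y. y \<in> N \<and> pa y = Some x \<and> P y"
    and "\<And>x. x \<in> N \<Longrightarrow> \<not> P x \<Longrightarrow> x \<noteq> root \<or> (\<exists>y\<in>N. pa y = Some root) \<Longrightarrow>
           primary_path N pa P x (L x) \<and> V (L x) = x"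
  shows "plp_inv N pa P L V"
  using assms by (simp add: plp_inv_def)

lemma primary_path_cong:
  assumes "primary_path N pa P x j" "\<And>y. y \<in> N \<Longrightarrow> pa' y = pa y" "\<And>y. y \<in> N \<Longrightarrow> P' y = P y" "N \<subseteq> N'"
  shows "primary_path N' pa' P' x j"
  using assms by induction (auto intro: primary_path.intros)

text \<open>The parent functions of two trees need to agree only on the nodes, since
  \<open>parent\<close> is defined for other arguments too.\<close>

lemma plp_inv_cong:
  assumes "\<And>x. x \<in> N \<Longrightarrow> pa' x = pa x"
  shows "plp_inv N pa' P L V \<longleftrightarrow> plp_inv N pa P L V"
proof -
  have "primary_path N pa' P x j \<longleftrightarrow> primary_path N pa P x j" for x j
    using assms primary_path_cong[of N pa P x j pa' P N] primary_path_cong[of N pa' P x j pa P N]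
    by auto
  then show ?thesis
    unfolding plp_inv_def using assms by (auto cong: conj_cong)
qed

lemma primary_path_Leaf:
  assumes "rooted_tree N pa" "primary_path N pa P (Leaf i) j"
  shows "j = i"
  using assms(2)
proof cases
  case (step y)
  then have "y \<noteq> root" using assms(1) by (auto simp: rooted_tree_def)
  then show ?thesis using assms(1) step by (auto simp: rooted_tree_def)
qed

lemma primary_path_child:
  assumes "primary_path N pa P x j" "x = Leaf j \<Longrightarrow> False"
  obtains y where "y \<in> N" "pa y = Some x" "P y" "primary_path N pa P y j"
  using assms by (cases rule: primary_path.cases) auto

lemma primary_path_end:
  assumes "primary_path N pa P x j" "x \<in> N"
  shows "Leaf j \<in> N"
  using assms by induction auto

lemma plp_inv_primary_child:
  assumes "plp_inv N pa P L V" "x \<in> N" "\<exists>y\<in>N. pa y = Some x"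
  obtains z where "z \<in> N" "pa z = Some x" "P z"
    "\<And>z'. z' \<in> N \<Longrightarrow> pa z' = Some x \<Longrightarrow> P z' \<Longrightarrow> z' = z"
proof -
  have "\<exists>!y. y \<in> N \<and> pa y = Some x \<and> P y"
    using assms by (simp add: plp_inv_def)
  then show ?thesis using that by blast
qed

lemma primary_child_unique:
  assumes "plp_inv N pa P L V" "x \<in> N"
    and "y \<in> N" "pa y = Some x" "P y" "z \<in> N" "pa z = Some x" "P z"
  shows "y = z"
  using assms unfolding plp_inv_def by blast

lemma primary_path_unique:
  assumes T: "rooted_tree N pa" and I: "plp_inv N pa P L V"
    and "primary_path N pa P x i" "primary_path N pa P x j" "x \<in> N"
  shows "i = j"
  using assms(3,4,5)
proof induction
  case (leaf i)
  then show ?case using primary_path_Leaf[OF T] by blast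
next
  case (step y x i)
  have "x \<noteq> Leaf j"
    using T step.hyps(1,2) by (auto simp: rooted_tree_def)
  with step.prems obtain z where "z \<in> N" "pa z = Some x" "P z" "primary_path N pa P z j"
    by (auto elim: primary_path_child)
  then show ?case using primary_child_unique[OF I] step by metis
qed

text \<open>Climb from \<open>Leaf i\<close> as long as the node is primary. Ranks fall and the root
  is secondary, so the climb ends at a secondary node \<open>x\<close>. Its primary path ends in
  \<open>Leaf i\<close> and is unique, hence \<open>L x = i\<close> and \<open>V i = x\<close>. So
  \<open>inv_plp\<close> finds the top of a path in one step.\<close>

lemma plp_inv_V:
  assumes T: "rooted_tree N pa" and I: "plp_inv N pa P L V" and i: "Leaf i \<in> N"
  shows "V i \<in> N" "\<not> P (V i)" "L (V i) = i" "primary_path N pa P (V i) i"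
    "V i \<noteq> root \<or> (\<exists>y\<in>N. pa y = Some root)"
proof -
  obtain rk :: "'a node \<Rightarrow> nat" where rk: "\<And>x y. x \<in> N \<Longrightarrow> pa x = Some y \<Longrightarrow> rk y < rk x"
    using T by (auto simp: rooted_tree_def)
  have "\<exists>x\<in>N. \<not> P x \<and> primary_path N pa P x i \<and> (x \<noteq> root \<or> (\<exists>y\<in>N. pa y = Some root))"
    if "y \<in> N" "primary_path N pa P y i" for y
    using that
  proof (induction "rk y" arbitrary: y rule: less_induct)
    case less
    show ?case
    proof (cases "P y")
      case False
      moreover have "y \<noteq> root \<or> (\<exists>z\<in>N. pa z = Some root)"
        using less.prems(2) by (auto elim: primary_path_child)
      ultimately show ?thesis using less.prems by blast
    next
      case True
      then have "y \<noteq> root" using I by (auto simp: plp_inv_def)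
      then obtain u where u: "Inner u \<in> N" "pa y = Some (Inner u)"
        using T less.prems(1) by (auto simp: rooted_tree_def)
      show ?thesis
        using less.hyps[OF rk[OF less.prems(1) u(2)] u(1)] u True less.prems
        by (auto intro: primary_path.step)
    qed
  qed
  from this[OF i primary_path.leaf] obtain x where
    x: "x \<in> N" "\<not> P x" "primary_path N pa P x i" "x \<noteq> root \<or> (\<exists>y\<in>N. pa y = Some root)"
    by blast
  then have "primary_path N pa P x (L x)" "V (L x) = x"
    using I by (auto simp: plp_inv_def)
  moreover from this have "L x = i"
    using primary_path_unique[OF T I _ x(3,1)] by blast
  ultimately have "V i = x" by simp
  then show "V i \<in> N" "\<not> P (V i)" "L (V i) = i" "primary_path N pa P (V i) i"
    "V i \<noteq> root \<or> (\<exists>y\<in>N. pa y = Some root)"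
    using x \<open>L x = i\<close> by simp_all
qed

text \<open>The new leaf is a primary path of its own. The sibling \<open>y\<close> guarantees that
  \<open>v\<close> had children before, hence already has a primary child.\<close>

lemma plp_inv_attach_leaf:
  assumes T: "rooted_tree N pa" and I: "plp_inv N pa P L V" and k: "Leaf k \<notin> N"
    and v: "v \<in> N" "pa (Leaf k) = Some v" and y: "y \<in> N" "pa y = Some v"
  shows "plp_inv (insert (Leaf k) N) pa (P(Leaf k := False)) (L(Leaf k := k)) (V(k := Leaf k))"
proof -
  let ?N = "insert (Leaf k) N" and ?P = "P(Leaf k := False)"
  have path: "primary_path ?N pa ?P x j" if "primary_path N pa P x j" for x j
    using that by (rule primary_path_cong) (use k in auto)
  have noleaf: "pa z \<noteq> Some (Leaf k)" if "z \<in> ?N" for z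
    using that T v k by (cases "z = root") (auto simp: rooted_tree_def)
  have unique: "\<exists>!z. z \<in> ?N \<and> pa z = Some x \<and> ?P z" if x: "x \<in> ?N" "\<exists>z\<in>?N. pa z = Some x" for x
  proof -
    have "x \<in> N" using x noleaf by blast
    moreover have "\<exists>z\<in>N. pa z = Some x" using x v y by auto
    ultimately obtain z where z: "z \<in> N" "pa z = Some x" "P z"
      and zu: "\<And>z'. z' \<in> N \<Longrightarrow> pa z' = Some x \<Longrightarrow> P z' \<Longrightarrow> z' = z"
      by (rule plp_inv_primary_child[OF I]) blast
    show ?thesis
    proof (rule ex1I[of _ z])
      show "z \<in> ?N \<and> pa z = Some x \<and> ?P z" using z k by auto
    next
      fix z' assume z': "z' \<in> ?N \<and> pa z' = Some x \<and> ?P z'"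
      then have "z' \<noteq> Leaf k" by auto
      then show "z' = z" using zu[of z'] z' by auto
    qed
  qed
  have paths: "primary_path ?N pa ?P x ((L(Leaf k := k)) x) \<and> (V(k := Leaf k)) ((L(Leaf k := k)) x) = x"
    if x: "x \<in> ?N" "\<not> ?P x" "x \<noteq> root \<or> (\<exists>y\<in>?N. pa y = Some root)" for x
  proof (cases "x = Leaf k")
    case True
    then show ?thesis by (simp add: primary_path.leaf)
  next
    case False
    then have xN: "x \<in> N" "\<not> P x" using x by auto
    moreover have "x \<noteq> root \<or> (\<exists>y\<in>N. pa y = Some root)"
      using x(3) v y by auto
    ultimately have p: "primary_path N pa P x (L x)" "V (L x) = x"
      using I unfolding plp_inv_def by blast+
    moreover have "L x \<noteq> k" using primary_path_end[OF p(1) xN(1)] k by auto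
    ultimately show ?thesis using path False by simp
  qed
  have nr: "\<not> ?P root" using I by (auto simp: plp_inv_def)
  show ?thesis
    using nr unique paths by (rule plp_invI)
qed

text \<open>On every primary path the edge from \<open>q\<close> to \<open>y\<close> is replaced by
  \<open>q, v, y\<close>, which does not change where the path ends. If \<open>y\<close> was the top
  of its path, the new top is \<open>v\<close>, so the pointer moves from \<open>y\<close> to
  \<open>v\<close>.\<close>

lemma plp_inv_split_edge:
  assumes T: "rooted_tree N pa" and I: "plp_inv N pa P L V" and v: "v \<notin> N" "v \<noteq> root"
    and y: "y \<in> N" "pa y = Some q" and q: "q \<in> N"
    and pa': "pa' v = Some q" "pa' y = Some v" "\<And>x. x \<in> N \<Longrightarrow> x \<noteq> y \<Longrightarrow> pa' x = pa x"
  shows "plp_inv (insert v N) pa' (P(v := P y, y := True))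
           (if P y then L else L(v := L y)) (if P y then V else V(L y := v))"
proof -
  let ?N = "insert v N" and ?P = "P(v := P y, y := True)"
  have vy: "v \<noteq> y" using v y by blast
  have qv: "q \<noteq> v" using v q by blast
  have yr: "y \<noteq> root" using T y by (auto simp: rooted_tree_def)
  \<comment> \<open>All parents of old nodes are old nodes, so \<open>v\<close> has no children
    before \<open>y\<close> is moved below it.\<close>
  have closed: "pa z \<noteq> Some v" if "z \<in> N" for z
    using T v that by (cases "z = root") (auto simp: rooted_tree_def)
  have path: "primary_path ?N pa' ?P x j" if "primary_path N pa P x j" "x \<in> N" for x j
    using that
  proof induction
    case (step z x j)
    show ?case
    proof (cases "z = y")
      case True
      then have "x = q" "P y" using step y by auto
      have "primary_path ?N pa' ?P y j" using step.IH True y by blast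
      then have "primary_path ?N pa' ?P v j"
        by (rule primary_path.step[rotated -1]) (use y pa' in auto)
      then show ?thesis
        by (rule primary_path.step[rotated -1]) (use \<open>x = q\<close> \<open>P y\<close> pa' vy in auto)
    next
      case False
      have "primary_path ?N pa' ?P z j" using step.IH step.hyps by blast
      then show ?thesis
        by (rule primary_path.step[rotated -1]) (use False step.hyps pa' v in auto)
    qed
  qed (rule primary_path.leaf)
  have unique: "\<exists>!z. z \<in> ?N \<and> pa' z = Some x \<and> ?P z" if x: "x \<in> ?N" "\<exists>z\<in>?N. pa' z = Some x" for x
  proof (cases "x = v")
    case True
    show ?thesis
    proof (rule ex1I[of _ y])
      fix z assume "z \<in> ?N \<and> pa' z = Some x \<and> ?P z"
      then show "z = y" using True closed[of z] pa'(1) pa'(3)[of z] qv by (cases "z = v"; cases "z = y") auto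
    qed (use True y pa' in auto)
  next
    case False
    have "\<exists>z\<in>N. pa z = Some x"
      using x False y pa' by (metis insert_iff option.inject)
    then have "\<exists>!z. z \<in> N \<and> pa z = Some x \<and> P z"
      using I x False by (auto simp: plp_inv_def)
    then obtain z where z: "z \<in> N" "pa z = Some x" "P z"
      and zu: "\<And>z'. z' \<in> N \<Longrightarrow> pa z' = Some x \<Longrightarrow> P z' \<Longrightarrow> z' = z" by blast
    \<comment> \<open>If the primary child of \<open>x\<close> was \<open>y\<close>, then
      \<open>x = q\<close>, and \<open>v\<close> has taken its place.\<close>
    let ?z = "if z = y then v else z"
    show ?thesis
    proof (rule ex1I[of _ ?z])
      show "?z \<in> ?N \<and> pa' ?z = Some x \<and> ?P ?z"
        using z y pa' v vy by auto
    next
      fix z' assume z': "z' \<in> ?N \<and> pa' z' = Some x \<and> ?P z'"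
      show "z' = ?z"
      proof (cases "z' = v")
        case True
        then have "x = q" "P y" using z' pa' vy by auto
        then show ?thesis using zu[of y] y True by simp
      next
        case n: False
        then have "z' \<noteq> y" using z' pa' False by auto
        then show ?thesis using zu[of z'] z' n pa' z y by (auto split: if_splits)
      qed
    qed
  qed
  have pt: "primary_path N pa P x (L x) \<and> V (L x) = x"
    if "x \<in> N" "\<not> P x" "x \<noteq> root \<or> (\<exists>y\<in>N. pa y = Some root)" for x
    using I that by (auto simp: plp_inv_def)
  have paths: "primary_path ?N pa' ?P x ((if P y then L else L(v := L y)) x) \<and>
      (if P y then V else V(L y := v)) ((if P y then L else L(v := L y)) x) = x"
    if x: "x \<in> ?N" "\<not> ?P x" "x \<noteq> root \<or> (\<exists>y\<in>?N. pa' y = Some root)" for x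
  proof (cases "x = v")
    case True
    then have "\<not> P y" using x vy by auto
    have "primary_path ?N pa' ?P y (L y)"
      using path pt[of y] \<open>\<not> P y\<close> y yr by blast
    then have "primary_path ?N pa' ?P v (L y)"
      by (rule primary_path.step[rotated -1]) (use y pa' in auto)
    then show ?thesis using True \<open>\<not> P y\<close> by simp
  next
    case False
    then have xN: "x \<in> N" "\<not> P x" "x \<noteq> y" using x by (auto split: if_splits)
    moreover have "x \<noteq> root \<or> (\<exists>y\<in>N. pa y = Some root)"
      using x(3) y pa' q v(2) by (metis insert_iff option.inject)
    ultimately have p: "primary_path N pa P x (L x)" "V (L x) = x" using pt by blast+
    moreover have "L x \<noteq> L y" if "\<not> P y"
      using pt[of y] that y yr p xN by auto
    ultimately show ?thesis using path xN False by auto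
  qed
  have nr: "\<not> ?P root" using v yr I by (auto simp: plp_inv_def)
  show ?thesis
    using nr unique paths by (rule plp_invI)
qed

text \<open>Removing a primary leaf cuts the end off the path with top \<open>V i\<close>. Promoting
  the sibling \<open>y\<close> joins the whole path that started at \<open>y\<close> to it, so the
  path now has top \<open>V i\<close> and end \<open>L y\<close>. A secondary leaf is a path by
  itself and simply vanishes.\<close>

lemma plp_inv_detach_leaf:
  assumes T: "rooted_tree N pa" and I: "plp_inv N pa P L V" and i: "Leaf i \<in> N"
    and v: "pa (Leaf i) = Some v" and y: "y \<in> N" "pa y = Some v" "y \<noteq> Leaf i"
  shows "plp_inv (N - {Leaf i}) pa (if P (Leaf i) then P(y := True) else P)
           (if P (Leaf i) then L(V i := L y) else L) (if P (Leaf i) then V(L y := V i) else V)"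
proof -
  let ?N = "N - {Leaf i}" and ?P = "if P (Leaf i) then P(y := True) else P"
  let ?L = "if P (Leaf i) then L(V i := L y) else L"
  let ?V = "if P (Leaf i) then V(L y := V i) else V"
  have vN: "v \<in> N" using T i v by (auto simp: rooted_tree_def)
  have yr: "y \<noteq> root" using T y by (auto simp: rooted_tree_def)
  \<comment> \<open>At most one child of \<open>v\<close> is primary. So \<open>y\<close> is the top
    of a path and \<open>L y\<close> is meaningful.\<close>
  have ny: "\<not> P y" if "P (Leaf i)"
    using primary_child_unique[OF I vN i v that y(1,2)] y(3) by blast
  have path: "primary_path ?N pa ?P x j" if "primary_path N pa P x j" "j \<noteq> i" for x j
    using that
  proof induction
    case (step z x j)
    then have "z \<noteq> Leaf i" using primary_path_Leaf[OF T] by blast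
    moreover have "primary_path ?N pa ?P z j" using step.IH step.prems .
    ultimately show ?case
      by (intro primary_path.step[of z ?N pa x ?P j]) (use step.hyps in simp_all)
  qed (rule primary_path.leaf)
  have pt: "primary_path N pa P x (L x) \<and> V (L x) = x"
    if "x \<in> N" "\<not> P x" "x \<noteq> root \<or> (\<exists>y\<in>N. pa y = Some root)" for x
    using I that by (auto simp: plp_inv_def)
  have unique: "\<exists>!z. z \<in> ?N \<and> pa z = Some x \<and> ?P z" if x: "x \<in> ?N" "\<exists>z\<in>?N. pa z = Some x" for x
  proof -
    from x have "x \<in> N" "\<exists>z\<in>N. pa z = Some x" by auto
    then obtain z where z: "z \<in> N" "pa z = Some x" "P z"
      and zu: "\<And>z'. z' \<in> N \<Longrightarrow> pa z' = Some x \<Longrightarrow> P z' \<Longrightarrow> z' = z"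
      by (rule plp_inv_primary_child[OF I]) blast
    show ?thesis
    proof (cases "z = Leaf i")
      case True
      then have "x = v" "P (Leaf i)" using z v by auto
      show ?thesis
      proof (rule ex1I[of _ y])
        show "y \<in> ?N \<and> pa y = Some x \<and> ?P y" using y \<open>x = v\<close> \<open>P (Leaf i)\<close> by simp
      next
        fix z' assume z': "z' \<in> ?N \<and> pa z' = Some x \<and> ?P z'"
        show "z' = y"
        proof (rule ccontr)
          assume "z' \<noteq> y"
          then have "P z'" using z' \<open>P (Leaf i)\<close> by simp
          then show False using zu[of z'] z' True by simp
        qed
      qed
    next
      case False
      then have nv: "x \<noteq> v" if "P (Leaf i)" using zu[of "Leaf i"] i v that by auto
      show ?thesis
      proof (rule ex1I[of _ z])
        show "z \<in> ?N \<and> pa z = Some x \<and> ?P z" using z False by simp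
      next
        fix z' assume z': "z' \<in> ?N \<and> pa z' = Some x \<and> ?P z'"
        then have "P z'" using nv y(2) by (auto split: if_splits)
        then show "z' = z" using zu[of z'] z' by simp
      qed
    qed
  qed
  have paths: "primary_path ?N pa ?P x (?L x) \<and> ?V (?L x) = x"
    if x: "x \<in> ?N" "\<not> ?P x" "x \<noteq> root \<or> (\<exists>y\<in>?N. pa y = Some root)" for x
  proof -
    have x': "x \<in> N" "\<not> P x" "x \<noteq> root \<or> (\<exists>y\<in>N. pa y = Some root)"
      using x by (auto split: if_splits)
    have p: "primary_path N pa P x (L x)" "V (L x) = x" using pt[OF x'] by blast+
    show ?thesis
    proof (cases "L x = i")
      case True
      then have Vi: "V i = x" using p by simp
      have P: "P (Leaf i)"
      proof (rule ccontr)
        assume "\<not> P (Leaf i)"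
        then have "V (L (Leaf i)) = Leaf i" "primary_path N pa P (Leaf i) (L (Leaf i))"
          using pt[OF i] by auto
        then show False using Vi x(1) primary_path_Leaf[OF T] by fastforce
      qed
      have Ly: "primary_path N pa P y (L y)" "V (L y) = y" using pt y(1) ny[OF P] yr by blast+
      have "L y \<noteq> i"
      proof
        assume "L y = i"
        then have "x = y" using Vi Ly by simp
        then show False using x(2) P by auto
      qed
      then have "primary_path ?N pa ?P y (L y)" using path Ly by blast
      then have pv: "primary_path ?N pa ?P v (L y)"
        by (rule primary_path.step[rotated -1]) (use y P in auto)
      \<comment> \<open>Every path that ended in \<open>Leaf i\<close> arrives there from
        \<open>v\<close>; from \<open>v\<close> it is now continued through
        \<open>y\<close>.\<close>
      have "primary_path ?N pa ?P z (L y)" if "primary_path N pa P z j" "j = i" "z \<noteq> Leaf i" for z j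
        using that
      proof induction
        case (step a z j)
        show ?case
        proof (cases "a = Leaf i")
          case True
          then have "z = v" using step.hyps v by simp
          then show ?thesis using pv by (simp only:)
        next
          case False
          then have "primary_path ?N pa ?P a (L y)" using step by blast
          then show ?thesis
            by (rule primary_path.step[rotated -1]) (use False step.hyps in auto)
        qed
      qed simp
      then show ?thesis using p True P Vi x(1) by auto
    next
      case False
      then have "V i \<noteq> x" using plp_inv_V(3)[OF T I i] by auto
      moreover have "L x \<noteq> L y" if "P (Leaf i)"
      proof
        assume "L x = L y"
        moreover have "V (L y) = y" using pt y(1) ny[OF that] yr by blast
        ultimately have "x = y" using p by simp
        then show False using x(2) that by simp
      qed
      ultimately show ?thesis using path[OF p(1) False] p(2) by auto
    qed
  qed
  have nr: "\<not> ?P root" using yr I by (auto simp: plp_inv_def)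
  show ?thesis
    using nr unique paths by (rule plp_invI)
qed

text \<open>This reverses an edge split: a primary path through \<open>v\<close> must go on to
  \<open>y\<close>, its only child, so \<open>v\<close> can be skipped, and \<open>y\<close>
  inherits the flag of \<open>v\<close> and, if \<open>v\<close> was a top, its pointer.\<close>

lemma plp_inv_merge_edges:
  assumes T: "rooted_tree N pa" and I: "plp_inv N pa P L V"
    and v: "v = Inner u" "v \<in> N" "v \<noteq> root" "pa v = Some q"
    and y: "y \<in> N" "pa y = Some v" "\<And>x. x \<in> N \<Longrightarrow> pa x = Some v \<Longrightarrow> x = y"
    and pa': "pa' y = Some q" "\<And>x. x \<in> N \<Longrightarrow> x \<noteq> v \<Longrightarrow> x \<noteq> y \<Longrightarrow> pa' x = pa x"
  shows "plp_inv (N - {v}) pa' (P(y := P v))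
           (if P v then L else L(y := L v)) (if P v then V else V(L v := y))"
proof -
  let ?N = "N - {v}" and ?P = "P(y := P v)"
  let ?L = "if P v then L else L(y := L v)" and ?V = "if P v then V else V(L v := y)"
  obtain rk :: "'a node \<Rightarrow> nat" where rk: "\<And>x y. x \<in> N \<Longrightarrow> pa x = Some y \<Longrightarrow> rk y < rk x"
    using T by (auto simp: rooted_tree_def)
  have vy: "v \<noteq> y" using rk[OF y(1,2)] by auto
  have qv: "q \<noteq> v" using rk[OF v(2,4)] by auto
  have yr: "y \<noteq> root" using T y(1,2) by (auto simp: rooted_tree_def)
  have pt: "primary_path N pa P x (L x) \<and> V (L x) = x"
    if "x \<in> N" "\<not> P x" "x \<noteq> root \<or> (\<exists>y\<in>N. pa y = Some root)" for x
    using I that by (auto simp: plp_inv_def)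
  \<comment> \<open>The node \<open>v\<close> is gone, so a path that starts at \<open>v\<close> has
    to be restated as one that starts at \<open>y\<close>; the induction needs both cases at
    once.\<close>
  have path: "if x = v then primary_path ?N pa' ?P y j else primary_path ?N pa' ?P x j"
    if "primary_path N pa P x j" for x j
    using that
  proof induction
    case (leaf j)
    show ?case using v(1) by (simp add: primary_path.leaf)
  next
    case (step z x j)
    show ?case
    proof (cases "x = v")
      case True
      then have "z = y" using y(3) step by blast
      then show ?thesis using True vy step by simp
    next
      case False
      show ?thesis
      proof (cases "z = v")
        case True
        then have "primary_path ?N pa' ?P y j" using step by simp
        then have "primary_path ?N pa' ?P x j"
          by (rule primary_path.step[rotated -1]) (use True step.hyps v pa' y(1,2) vy in auto)
        then show ?thesis using False by simp
      next
        case n: False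
        then have zy: "z \<noteq> y" using False step.hyps y(1,2) by auto
        have "primary_path ?N pa' ?P z j" using step.IH n by simp
        then have "primary_path ?N pa' ?P x j"
          by (rule primary_path.step[rotated -1]) (use n zy step.hyps pa' in auto)
        then show ?thesis using False by simp
      qed
    qed
  qed
  have unique: "\<exists>!z. z \<in> ?N \<and> pa' z = Some x \<and> ?P z" if x: "x \<in> ?N" "\<exists>z\<in>?N. pa' z = Some x" for x
  proof -
    have "x \<in> N" using x by simp
    moreover have "\<exists>z\<in>N. pa z = Some x"
      using x v pa' by (metis DiffD1 DiffD2 insertI1 option.inject)
    ultimately obtain z where z: "z \<in> N" "pa z = Some x" "P z"
      and zu: "\<And>z'. z' \<in> N \<Longrightarrow> pa z' = Some x \<Longrightarrow> P z' \<Longrightarrow> z' = z"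
      by (rule plp_inv_primary_child[OF I]) blast
    let ?z = "if z = v then y else z"
    show ?thesis
    proof (rule ex1I[of _ ?z])
      show "?z \<in> ?N \<and> pa' ?z = Some x \<and> ?P ?z"
        using z y(1,2) v pa' vy x by (cases "z = y") auto
    next
      fix z' assume z': "z' \<in> ?N \<and> pa' z' = Some x \<and> ?P z'"
      show "z' = ?z"
      proof (cases "z' = y")
        case True
        then have "x = q" "P v" using z' pa' by auto
        then show ?thesis using zu[of v] v True by simp
      next
        case False
        then have "z' = z" using z' zu[of z'] pa' by auto
        then show ?thesis using z' by auto
      qed
    qed
  qed
  have paths: "primary_path ?N pa' ?P x (?L x) \<and> ?V (?L x) = x"
    if x: "x \<in> ?N" "\<not> ?P x" "x \<noteq> root \<or> (\<exists>y\<in>?N. pa' y = Some root)" for x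
  proof (cases "x = y")
    case True
    then have "\<not> P v" using x by simp
    then have "primary_path N pa P v (L v)" using pt v(2,3) by blast
    then have "primary_path ?N pa' ?P y (L v)" using path[of v] by simp
    then show ?thesis using True \<open>\<not> P v\<close> by simp
  next
    case False
    then have xN: "x \<in> N" "\<not> P x" using x by auto
    moreover have "x \<noteq> root \<or> (\<exists>y\<in>N. pa y = Some root)"
      using x(3) v pa' by (metis DiffD1 DiffD2 insertI1 option.inject)
    ultimately have p: "primary_path N pa P x (L x)" "V (L x) = x" using pt by blast+
    moreover have "L x \<noteq> L v" if "\<not> P v"
      using pt[of v] that v(2,3) p x by auto
    ultimately show ?thesis using path[of x "L x"] x(1) False by auto
  qed
  have nr: "\<not> ?P root" using yr I by (auto simp: plp_inv_def)
  show ?thesis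
    using nr unique paths by (rule plp_invI)
qed

text \<open>The new leaf takes the place and the flag of the old one. Only the path ending in
  \<open>Leaf i\<close> is affected, and its top is \<open>V i\<close> if the leaf is primary and
  the leaf itself otherwise.\<close>

lemma plp_inv_rename_leaf:
  assumes T: "rooted_tree N pa" and I: "plp_inv N pa P L V" and i: "Leaf i \<in> N"
    and k: "Leaf k \<notin> N"
    and pa': "pa' (Leaf k) = pa (Leaf i)" "\<And>x. x \<in> N \<Longrightarrow> pa' x = pa x"
  shows "plp_inv (insert (Leaf k) (N - {Leaf i})) pa' (P(Leaf k := P (Leaf i)))
           (if P (Leaf i) then L(V i := k) else L(Leaf k := k))
           (if P (Leaf i) then V(k := V i) else V(k := Leaf k))"
proof -
  let ?N = "insert (Leaf k) (N - {Leaf i})" and ?P = "P(Leaf k := P (Leaf i))"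
  let ?L = "if P (Leaf i) then L(V i := k) else L(Leaf k := k)"
  let ?V = "if P (Leaf i) then V(k := V i) else V(k := Leaf k)"
  obtain q where q: "q \<in> N" "pa (Leaf i) = Some q"
    using T i by (auto simp: rooted_tree_def)
  have noleaf: "pa z \<noteq> Some (Leaf j)" if "z \<in> N" for z j
    using T that by (cases "z = root") (auto simp: rooted_tree_def)
  have path: "x \<noteq> Leaf i \<longrightarrow> primary_path ?N pa' ?P x (if j = i then k else j)"
    if "primary_path N pa P x j" for x j
    using that
  proof induction
    case (leaf j)
    show ?case by (auto intro: primary_path.leaf)
  next
    case (step z x j)
    show ?case
    proof (cases "z = Leaf i")
      case True
      then have "j = i" using primary_path_Leaf[OF T] step.hyps by blast
      have "primary_path ?N pa' ?P x k"
        by (rule primary_path.step[OF _ _ _ primary_path.leaf]) (use True step.hyps pa' in auto)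
      then have "primary_path ?N pa' ?P x (if j = i then k else j)"
        using \<open>j = i\<close> by (simp only: refl if_True)
      then show ?thesis ..
    next
      case False
      then have "primary_path ?N pa' ?P z (if j = i then k else j)" using step.IH by blast
      then have "primary_path ?N pa' ?P x (if j = i then k else j)"
        by (rule primary_path.step[rotated -1]) (use False step.hyps pa' k in auto)
      then show ?thesis ..
    qed
  qed
  have pt: "primary_path N pa P x (L x) \<and> V (L x) = x"
    if "x \<in> N" "\<not> P x" "x \<noteq> root \<or> (\<exists>y\<in>N. pa y = Some root)" for x
    using I that by (auto simp: plp_inv_def)
  have unique: "\<exists>!z. z \<in> ?N \<and> pa' z = Some x \<and> ?P z" if x: "x \<in> ?N" "\<exists>z\<in>?N. pa' z = Some x" for x
  proof -
    have ch: "\<exists>z\<in>N. pa z = Some x"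
      using x i pa' by auto
    then have "x \<in> N" using x noleaf by auto
    from this ch obtain z where z: "z \<in> N" "pa z = Some x" "P z"
      and zu: "\<And>z'. z' \<in> N \<Longrightarrow> pa z' = Some x \<Longrightarrow> P z' \<Longrightarrow> z' = z"
      by (rule plp_inv_primary_child[OF I]) blast
    let ?z = "if z = Leaf i then Leaf k else z"
    show ?thesis
    proof (rule ex1I[of _ ?z])
      show "?z \<in> ?N \<and> pa' ?z = Some x \<and> ?P ?z"
        using z pa' k by auto
    next
      fix z' assume z': "z' \<in> ?N \<and> pa' z' = Some x \<and> ?P z'"
      then show "z' = ?z"
        using zu[of z'] zu[of "Leaf i"] pa' i by (cases "z' = Leaf k") auto
    qed
  qed
  have paths: "primary_path ?N pa' ?P x (?L x) \<and> ?V (?L x) = x"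
    if x: "x \<in> ?N" "\<not> ?P x" "x \<noteq> root \<or> (\<exists>y\<in>?N. pa' y = Some root)" for x
  proof (cases "x = Leaf k")
    case True
    then have "\<not> P (Leaf i)" using x by simp
    then show ?thesis using True by (auto intro: primary_path.leaf)
  next
    case False
    then have xN: "x \<in> N" "\<not> P x" "x \<noteq> Leaf i" using x by auto
    moreover have "x \<noteq> root \<or> (\<exists>y\<in>N. pa y = Some root)"
      using x(3) i pa' by auto
    ultimately have p: "primary_path N pa P x (L x)" "V (L x) = x" using pt by blast+
    have Lk: "L x \<noteq> k" using primary_path_end[OF p(1) xN(1)] k by auto
    have p': "primary_path ?N pa' ?P x (if L x = i then k else L x)"
      using path[OF p(1)] xN(3) by blast
    show ?thesis
    proof (cases "P (Leaf i)")
      case True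
      show ?thesis
      proof (cases "L x = i")
        case True
        then have "V i = x" using p by simp
        then show ?thesis using p' True \<open>P (Leaf i)\<close> by simp
      next
        case False
        then have "V i \<noteq> x" using plp_inv_V(3)[OF T I i] by auto
        then show ?thesis using p' p False True Lk by simp
      qed
    next
      case nP: False
      then have "V (L (Leaf i)) = Leaf i" "primary_path N pa P (Leaf i) (L (Leaf i))"
        using pt[OF i] by auto
      then have "L x \<noteq> i" using p xN primary_path_Leaf[OF T] by metis
      then show ?thesis using p' p nP False Lk by simp
    qed
  qed
  have nr: "\<not> ?P root" using I by (auto simp: plp_inv_def)
  show ?thesis
    using nr unique paths by (rule plp_invI)
qed


section \<open>The primary-leaf-pointer method\<close>

lemma plp_invariant_iff:
  "plp_invariant t s \<longleftrightarrow> plp_inv (nodes t) (parent t) (prim s) (plp s) (inv_plp s)"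
proof -
  have "primary_leaf t s x j \<longleftrightarrow> primary_path (nodes t) (parent t) (prim s) x j" for x j
  proof
    assume "primary_leaf t s x j"
    then show "primary_path (nodes t) (parent t) (prim s) x j"
      by induction (auto simp: children_def intro: primary_path.intros)
  next
    assume "primary_path (nodes t) (parent t) (prim s) x j"
    then show "primary_leaf t s x j"
      by induction (auto simp: children_def intro: primary_leaf.intros)
  qed
  moreover have "children t x \<noteq> {} \<longleftrightarrow> (\<exists>y\<in>nodes t. parent t y = Some x)" for x
    by (auto simp: children_def)
  moreover have "y \<in> children t x \<and> prim s y \<longleftrightarrow> y \<in> nodes t \<and> parent t y = Some x \<and> prim s y" for x y
    by (auto simp: children_def)
  ultimately show ?thesis
    unfolding plp_invariant_def plp_inv_def by presburger
qed

lemma rooted_tree_nodes: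
  assumes ok: "sst_ok t"
  shows "rooted_tree (nodes t) (parent t)"
proof -
  have "\<exists>u. Inner u \<in> nodes t \<and> parent t x = Some (Inner u)" if x: "x \<in> nodes t" "x \<noteq> root" for x
  proof -
    have "label t x \<noteq> []"
      using x leaf_label_nonempty[OF ok] by (cases x) auto
    then obtain y where "parent t x = Some y" by (simp add: parent_def)
    then show ?thesis by (auto simp: Inner_in_nodes elim: parent_SomeE)
  qed
  moreover have "\<exists>rk :: 'a node \<Rightarrow> nat. \<forall>x\<in>nodes t. \<forall>y. parent t x = Some y \<longrightarrow> rk y < rk x"
    by (rule exI[of _ "\<lambda>x. length (label t x)"]) (auto intro: length_label_parent)
  ultimately show ?thesis by (simp add: rooted_tree_def)
qed

section \<open>Changes of the tree under leaf operations\<close>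

lemma rooted_tree_remove_leaf:
  "rooted_tree N pa \<Longrightarrow> rooted_tree (N - {Leaf k}) pa"
  unfolding rooted_tree_def by blast

lemma ctrie_inner_empty [simp]: "ctrie_inner {} = {[]}"
  by (auto simp: ctrie_inner_def trie_words_def)

text \<open>A node created by a split keeps the lower end of the split edge as a child, and an old
  inner node has a child as soon as the tree has any leaf. So only the first leaf of the tree has no
  sibling. This settles the case in which \<open>other_child\<close> finds nothing.\<close>

lemma grows_only_child:
  assumes g: "grows t t' k" and v: "parent t' (Leaf k) = Some v" and ch: "children t' v = {Leaf k}"
  shows "nodes t = {root}" "v = root" "nodes t' = {root, Leaf k}"
proof -
  have ok: "sst_ok t" using g by (simp add: grows_def)
  obtain p where p: "parent t' (Leaf k) = Some (Inner p)" "Leaf k \<notin> nodes t"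
    "nodes t' = insert (Leaf k) (insert (Inner p) (nodes t))"
    and old: "Inner p \<in> nodes t \<longrightarrow> (\<forall>x\<in>nodes t. parent t' x = parent t x)"
    and new: "Inner p \<notin> nodes t \<longrightarrow> (\<exists>y\<in>nodes t. \<exists>q\<in>nodes t. parent t y = Some q \<and>
       parent t' (Inner p) = Some q \<and> parent t' y = Some (Inner p) \<and>
       (\<forall>x\<in>nodes t. x \<noteq> y \<longrightarrow> parent t' x = parent t x))"
    by (rule grows_tree[OF g])
  have vp: "v = Inner p" using v p by simp
  have no: "parent t' x \<noteq> Some (Inner p)" if "x \<in> nodes t" for x
  proof
    assume "parent t' x = Some (Inner p)"
    then have "x \<in> children t' v" using that p(3) vp by (simp add: children_def)
    then show False using ch that p(2) by auto
  qed
  have pn: "Inner p \<in> nodes t"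
    using new no by blast
  have "leaf_words t = {}"
  proof (rule ccontr)
    assume "leaf_words t \<noteq> {}"
    then obtain w where w: "w \<in> leaf_words t" by blast
    then have "w \<noteq> []" using ok by (auto simp: leaf_words_def sst_ok_def)
    then have "\<exists>w\<in>leaf_words t. strict_prefix p w"
      using w pn ctrie_inner_strict_prefix[of p "leaf_words t"]
      by (cases "p = []") (auto simp: Inner_in_nodes strict_prefix_def)
    then obtain w where "w \<in> leaf_words t" "strict_prefix p w" by blast
    then have "children t (Inner p) \<noteq> {}"
      using pn by (intro ex_child) (auto simp: Inner_in_nodes)
    then show False using no old pn by (auto simp: children_def)
  qed
  then show n: "nodes t = {root}"
    by (auto simp: nodes_def leaf_words_def)
  then show "v = root" "nodes t' = {root, Leaf k}" using pn vp p by auto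
qed

lemma start_less_act:
  assumes "sst_ok t" "\<not> pending t" "window t \<noteq> []"
  shows "start t < act t"
proof (rule ccontr)
  assume n: "\<not> start t < act t"
  then have "leaf_words t = {}" by (simp add: leaf_words_def)
  moreover have "act t < length (input t)"
    using n assms(1,3) by (auto simp: sst_ok_def window_def)
  ultimately show False using assms(2) by (simp add: pending_def trie_words_def)
qed

lemma grows_insert_leaf:
  assumes "sst_ok t" "leaf_step M Insertion t s t' s' n"
  shows "grows t t' (act t)"
  using assms leaf_step_ok[OF assms]
  by (auto simp: grows_def insert_leaf_def sst_ok_def)

lemma grows_remove_leaf:
  assumes "sst_ok t" "leaf_step M Deletion t s t' s' n" "\<not> shortens t"
  shows "grows t' t (start t)"
proof -
  have "start t < act t" using assms by (intro start_less_act) auto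
  moreover have "t' = remove_leaf t" using assms by (auto simp: Let_def)
  ultimately show ?thesis
    using assms(1) leaf_step_ok[OF assms(1,2)] by (auto simp: grows_def remove_leaf_def)
qed

text \<open>The active suffix is a prefix of the window and longer than the label \<open>p\<close>
  of the leaf's parent. Hence both words leave the trie of the remaining leaves at the same
  \<open>p\<close>, and the inner nodes of both trees coincide.\<close>

lemma shorten_leaf_tree:
  assumes ok: "sst_ok t" and st: "leaf_step M Deletion t s t' s' n" and sh: "shortens t"
  shows "Leaf (start t) \<in> nodes t" "Leaf (act t) \<notin> nodes t"
    "nodes t' = insert (Leaf (act t)) (nodes t - {Leaf (start t)})"
    "parent t' (Leaf (act t)) = parent t (Leaf (start t))" "parent t' x = parent t x"
proof -
  let ?i = "start t" and ?k = "act t" and ?T = "input t"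
  let ?J = "{Suc ?i..<?k}"
  let ?A = "(\<lambda>j. drop j ?T) ` ?J"
  let ?w = "drop ?i ?T" and ?u = "drop ?k ?T"
  have ik: "?i < ?k" using ok st by (intro start_less_act) auto
  have t': "t' = shorten_leaf t" using st sh by (auto simp: Let_def)
  have ok': "sst_ok t'" using leaf_step_ok[OF ok st] by simp
  have inp: "input t' = ?T" by (simp add: t' shorten_leaf_def)
  have idx: "{?i..<?k} = insert ?i ?J" "{start t'..<act t'} = insert ?k ?J"
    using ik by (auto simp: t' shorten_leaf_def)
  have w: "leaf_words t = insert ?w ?A" "?w \<noteq> []" "?w \<notin> trie_words ?A"
    "\<And>v. v \<in> ?A \<Longrightarrow> \<not> prefix v ?w"
    using sst_ok_insert[OF ok idx(1)] by auto
  have u: "leaf_words t' = insert ?u ?A" "?u \<noteq> []" "?u \<notin> trie_words ?A"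
    "\<And>v. v \<in> ?A \<Longrightarrow> \<not> prefix v ?u"
    using sst_ok_insert[OF ok' idx(2)] by (auto simp: inp)
  obtain p where bp: "branch_point ?A ?w p" using ex_branch_point by blast
  have Iw: "ctrie_inner (leaf_words t) = insert p (ctrie_inner ?A)"
    using ctrie_inner_insert[OF bp w(2-4)] w(1) by simp
  have paw: "parent t (Leaf ?i) = Some (Inner p)"
    using branch_point_max[OF bp w(2-4)] w(1) Iw branch_point_strict_prefix[OF bp w(2,3)]
    by (intro parent_eqI) (auto simp: strict_prefix_def)
  have uw: "prefix ?u ?w" "length p < length ?u"
    using sh paw by (auto simp: shortens_def active_suffix_def window_def)
  have "prefix p ?u"
    using bp uw by (auto simp: branch_point_def intro: prefix_length_prefix)
  \<comment> \<open>Prefixes of the shorter word are prefixes of the window, so \<open>p\<close>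
    remains the greatest one that is present.\<close>
  then have bu: "branch_point ?A ?u p"
    using bp uw(1) by (auto simp: branch_point_def dest: prefix_order.trans)
  have Iu: "ctrie_inner (leaf_words t') = insert p (ctrie_inner ?A)"
    using ctrie_inner_insert[OF bu u(2-4)] u(1) by simp
  have pau: "parent t' (Leaf ?k) = Some (Inner p)"
    using branch_point_max[OF bu u(2-4)] u(1) Iu branch_point_strict_prefix[OF bu u(2,3)]
    by (intro parent_eqI) (auto simp: strict_prefix_def inp)
  show "Leaf ?i \<in> nodes t" "Leaf ?k \<notin> nodes t" using ik by (auto simp: Leaf_in_nodes)
  show "nodes t' = insert (Leaf ?k) (nodes t - {Leaf ?i})"
    unfolding nodes_def Iw Iu idx by auto
  show "parent t' (Leaf ?k) = parent t (Leaf ?i)" using paw pau by simp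
  show "parent t' x = parent t x"
    by (rule parent_cong) (simp_all add: label_cong[OF inp] Iw Iu)
qed

text \<open>A new branching would need the appended \<open>c\<close> right after a leaf word
  \<open>w\<close> and a different symbol after \<open>w\<close> inside another leaf word, against
  the maximality of leaf words.\<close>

lemma append_symbol_tree:
  assumes ok: "sst_ok t"
  shows "nodes (append_symbol c t) = nodes t"
    and "x \<in> nodes t \<Longrightarrow> parent (append_symbol c t) x = parent t x"
proof -
  let ?t = "append_symbol c t" and ?A = "leaf_words t"
  have drop: "drop j (input ?t) = drop j (input t) @ [c]" if "j < act t" for j
    using ok that by (auto simp: append_symbol_def sst_ok_def)
  have idx: "{start ?t..<act ?t} = {start t..<act t}" by (simp add: append_symbol_def)
  have A: "leaf_words ?t = (\<lambda>w. w @ [c]) ` ?A"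
    unfolding leaf_words_def idx image_image using drop by (intro image_cong) auto
  have max: "\<not> strict_prefix w w'" if w: "w \<in> ?A" "w' \<in> ?A" for w w'
  proof -
    obtain j where "Leaf j \<in> nodes t" "w = label t (Leaf j)"
      using w(1) by (auto simp: leaf_words_def Leaf_in_nodes)
    then show ?thesis
      using leaf_label_maximal[OF ok] w(2) by (auto simp: trie_words_def)
  qed
  have old: "u @ [a] \<in> trie_words ?A"
    if a: "u @ [a] \<in> trie_words (leaf_words ?t)" and b: "u @ [b] \<in> trie_words (leaf_words ?t)"
      and ab: "a \<noteq> b" for u a b
  proof (rule ccontr)
    assume n: "u @ [a] \<notin> trie_words ?A"
    obtain w w' where w: "w \<in> ?A" "prefix (u @ [a]) (w @ [c])" and w': "w' \<in> ?A" "prefix (u @ [b]) (w' @ [c])"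
      using a b by (auto simp: trie_words_def A)
    have "\<not> prefix (u @ [a]) w" using n w(1) by (auto simp: trie_words_def)
    then have "u = w" "a = c" using w(2) by auto
    then have "prefix (w @ [b]) w'" using w'(2) ab by auto
    then have "strict_prefix w w'" by (auto simp: prefix_def strict_prefix_def)
    then show False using max w w' by blast
  qed
  have "trie_words ?A \<subseteq> trie_words (leaf_words ?t)"
    by (auto simp: trie_words_def A)
  then have I: "ctrie_inner (leaf_words ?t) = ctrie_inner ?A"
    using old unfolding ctrie_inner_def by blast
  show "nodes ?t = nodes t" unfolding nodes_def I idx ..
  show "parent ?t x = parent t x" if x: "x \<in> nodes t"
  proof (cases x)
    case (Inner u)
    then show ?thesis by (intro parent_cong) (auto simp: I)
  next
    case (Leaf j)
    let ?w = "label t x"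
    have ne: "?w \<noteq> []" "?w \<notin> ctrie_inner ?A"
      using leaf_label_nonempty[OF ok] leaf_not_inner[OF ok] x Leaf by auto
    then obtain y where "parent t x = Some y" by (simp add: parent_def)
    then obtain u where u: "y = Inner u" "u \<in> ctrie_inner ?A" "strict_prefix u ?w"
      and max: "\<And>v. v \<in> ctrie_inner ?A \<Longrightarrow> strict_prefix v ?w \<Longrightarrow> prefix v u"
      by (rule parent_SomeE) blast
    have lx: "label ?t x = ?w @ [c]" using drop[of j] x Leaf by (simp add: Leaf_in_nodes)
    have "parent ?t x = Some (Inner u)"
    proof (rule parent_eqI)
      fix v assume v: "v \<in> ctrie_inner (leaf_words ?t)" "strict_prefix v (label ?t x)"
      then have "prefix v ?w" by (auto simp: lx strict_prefix_def)
      \<comment> \<open>Besides strict prefixes of the old label, \<open>v\<close> could be the old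
        label itself; this is excluded because a leaf label is not inner.\<close>
      then show "prefix v u" using v(1) ne(2) max I by (auto simp: strict_prefix_def)
    qed (use u I lx in \<open>auto simp: strict_prefix_def\<close>)
    then show ?thesis using u \<open>parent t x = Some y\<close> by simp
  qed
qed

lemma set_child_list: "distinct (child_list t x)" "set (child_list t x) = children t x"
proof -
  have "\<exists>ys. distinct ys \<and> set ys = children t x"
    using finite_distinct_list[OF finite_children] by blast
  then have "distinct (child_list t x) \<and> set (child_list t x) = children t x"
    unfolding child_list_def by (rule someI_ex)
  then show "distinct (child_list t x)" "set (child_list t x) = children t x" by blast+
qed

section \<open>Correctness of the primary-leaf-pointer programs\<close>

lemmas prog_defs = bind_prog_def ret_def read_field_def write_field_def get_parent_def get_child_def

lemma other_child_cases:
  assumes x: "x \<in> children t v"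
  obtains n where "other_child v x t s = (None, s, n)" "children t v = {x}"
  | y n where "other_child v x t s = (Some y, s, n)" "y \<in> children t v" "y \<noteq> x"
proof -
  obtain z zs where z: "child_list t v = z # zs"
    using x set_child_list(2)[of t v] by (cases "child_list t v") auto
  have d: "z \<notin> set zs" and c: "children t v = insert z (set zs)"
    using set_child_list[of t v] z by auto
  show ?thesis
  proof (cases "z = x")
    case False
    then show ?thesis
      using that(2)[of z 1] z c by (simp add: other_child_def prog_defs)
  next
    case True
    show ?thesis
    proof (cases zs)
      case Nil
      then show ?thesis
        using that(1)[of 3] z c True by (simp add: other_child_def prog_defs)
    next
      case (Cons y ys)
      then show ?thesis
        using that(2)[of y 3] z c d True by (auto simp: other_child_def prog_defs)
    qed
  qed
qed

text \<open>Without the leaf, a node created by a split has a single child. This identifies the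
  child picked by the program, whose position in the child list is unspecified, with the lower end
  of the split edge.\<close>

lemma split_children:
  assumes ok: "sst_ok t" and new: "Inner p \<notin> nodes t" and q: "q \<in> nodes t"
    and pa: "parent t' (Inner p) = Some q" "\<And>x. x \<in> nodes t \<Longrightarrow> x \<noteq> y \<Longrightarrow> parent t' x = parent t x"
    and x: "x \<in> insert (Inner p) (nodes t)" "parent t' x = Some (Inner p)"
  shows "x = y"
proof (rule ccontr)
  assume "x \<noteq> y"
  have "x \<noteq> Inner p" using x pa(1) q new by auto
  then have "x \<in> nodes t" "parent t x = Some (Inner p)" using x pa(2)[of x] \<open>x \<noteq> y\<close> by auto
  then show False
    using rooted_tree_nodes[OF ok] new by (cases "x = root") (auto simp: rooted_tree_def)
qed

lemma plp_insert_invariant: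
  assumes ok: "sst_ok t" and I: "plp_invariant t s"
    and st: "leaf_step plp_method Insertion t s t' s' n"
  shows "plp_invariant t' s'"
proof -
  let ?k = "act t"
  have g: "grows t t' ?k" using grows_insert_leaf[OF ok st] .
  then have ok': "sst_ok t'" by (simp add: grows_def)
  obtain p where p: "parent t' (Leaf ?k) = Some (Inner p)" "Leaf ?k \<notin> nodes t"
    "nodes t' = insert (Leaf ?k) (insert (Inner p) (nodes t))"
    and old: "Inner p \<in> nodes t \<longrightarrow> (\<forall>x\<in>nodes t. parent t' x = parent t x)"
    and new: "Inner p \<notin> nodes t \<longrightarrow> (\<exists>y\<in>nodes t. \<exists>q\<in>nodes t. parent t y = Some q \<and>
       parent t' (Inner p) = Some q \<and> parent t' y = Some (Inner p) \<and>
       (\<forall>x\<in>nodes t. x \<noteq> y \<longrightarrow> parent t' x = parent t x))"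
    by (rule grows_tree[OF g])
  let ?v = "Inner p" and ?N = "insert (Inner p) (nodes t)"
  have run: "plp_insert ?k ?v (?v \<notin> nodes t) t' s = ((), s', n)"
    using st p(1) by (auto simp: plp_method_def Let_def)
  have kch: "Leaf ?k \<in> children t' ?v" using p by (simp add: children_def)
  have inv: "plp_inv (nodes t) (parent t) (prim s) (plp s) (inv_plp s)"
    using I by (simp add: plp_invariant_iff)
  have N: "nodes t' - {Leaf ?k} = ?N" using p by auto
  have T: "rooted_tree ?N (parent t')"
    using rooted_tree_remove_leaf[OF rooted_tree_nodes[OF ok'], of ?k] by (simp only: N)
  show ?thesis
  proof (rule other_child_cases[OF kch, of s])
    fix m assume oc: "other_child ?v (Leaf ?k) t' s = (None, s, m)" and one: "children t' ?v = {Leaf ?k}"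
    \<comment> \<open>This is the insertion of the first leaf: the tree consists of the root and one
      primary leaf.\<close>
    have nt: "?v = root" "nodes t' = {root, Leaf ?k}" using grows_only_child[OF g p(1) one] by auto
    have s': "prim s' = (prim s)(Leaf ?k := True)" "plp s' = (plp s)(root := ?k)"
      "inv_plp s' = (inv_plp s)(?k := root)"
      using run oc nt(1) by (auto simp: plp_insert_def set_plp_def prog_defs)
    have "\<not> prim s root" using I by (simp add: plp_invariant_def)
    moreover have par: "parent t' (Leaf ?k) = Some root" using p(1) nt(1) by simp
    moreover have "primary_path (nodes t') (parent t') (prim s') root ?k"
      using par by (intro primary_path.step[OF _ _ _ primary_path.leaf]) (auto simp: nt s')
    ultimately show ?thesis
      unfolding plp_invariant_iff by (intro plp_invI) (auto simp: nt s')
  next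
    fix y m assume oc: "other_child ?v (Leaf ?k) t' s = (Some y, s, m)"
      and y: "y \<in> children t' ?v" "y \<noteq> Leaf ?k"
    then have y': "y \<in> ?N" "parent t' y = Some ?v" using p(3) by (auto simp: children_def)
    have kN: "Leaf ?k \<notin> ?N" using p(2) by simp
    show ?thesis
    proof (cases "?v \<in> nodes t")
      case True
      then have N: "?N = nodes t" by auto
      have s': "prim s' = (prim s)(Leaf ?k := False)" "plp s' = (plp s)(Leaf ?k := ?k)"
        "inv_plp s' = (inv_plp s)(?k := Leaf ?k)"
        using run oc True by (auto simp: plp_insert_def set_plp_def prog_defs)
      have "plp_inv ?N (parent t') (prim s) (plp s) (inv_plp s)"
        unfolding N using inv plp_inv_cong[of "nodes t" "parent t'" "parent t"] old True by blast
      from plp_inv_attach_leaf[OF T this kN _ p(1) y'] show ?thesis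
        unfolding plp_invariant_iff by (simp add: s' p(3))
    next
      case False
      then obtain y0 q where y0: "y0 \<in> nodes t" "q \<in> nodes t" "parent t y0 = Some q"
        "parent t' ?v = Some q" "parent t' y0 = Some ?v"
        and rest: "\<And>x. x \<in> nodes t \<Longrightarrow> x \<noteq> y0 \<Longrightarrow> parent t' x = parent t x"
        using new by blast
      have y: "y = y0" using split_children[OF ok False y0(2,4) rest y'] by blast
      \<comment> \<open>The split is treated alone, on the tree in which \<open>?v\<close> has the
        single child \<open>y\<close>; the leaf is attached afterwards.\<close>
      have "plp_inv ?N (parent t') ((prim s)(?v := prim s y, y := True))
          (if prim s y then plp s else (plp s)(?v := plp s y))
          (if prim s y then inv_plp s else (inv_plp s)(plp s y := ?v))"
        unfolding y using False y0 rest
        by (intro plp_inv_split_edge[OF rooted_tree_nodes[OF ok] inv, where q = q]) auto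
      from plp_inv_attach_leaf[OF T this kN _ p(1) y']
      have "plp_inv (nodes t') (parent t') ((prim s)(?v := prim s y, y := True, Leaf ?k := False))
          ((if prim s y then plp s else (plp s)(?v := plp s y))(Leaf ?k := ?k))
          ((if prim s y then inv_plp s else (inv_plp s)(plp s y := ?v))(?k := Leaf ?k))"
        by (simp add: p(3))
      moreover have "prim s' = (prim s)(?v := prim s y, y := True, Leaf ?k := False)"
        "plp s' = (if prim s y then plp s else (plp s)(?v := plp s y))(Leaf ?k := ?k)"
        "inv_plp s' = (if prim s y then inv_plp s else (inv_plp s)(plp s y := ?v))(?k := Leaf ?k)"
        using run oc False
        by (auto simp: plp_insert_def inherit_def set_plp_def prog_defs split: if_splits)
      ultimately show ?thesis
        unfolding plp_invariant_iff by (simp only:)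
    qed
  qed
qed

lemma plp_remove_invariant:
  assumes ok: "sst_ok t" and I: "plp_invariant t s"
    and st: "leaf_step plp_method Deletion t s t' s' n" and sh: "\<not> shortens t"
  shows "plp_invariant t' s'"
proof -
  let ?i = "start t"
  have g: "grows t' t ?i" using grows_remove_leaf[OF ok st sh] .
  then have ok': "sst_ok t'" by (simp add: grows_def)
  obtain p where p: "parent t (Leaf ?i) = Some (Inner p)" "Leaf ?i \<notin> nodes t'"
    "nodes t = insert (Leaf ?i) (insert (Inner p) (nodes t'))"
    and old: "Inner p \<in> nodes t' \<longrightarrow> (\<forall>x\<in>nodes t'. parent t x = parent t' x)"
    and new: "Inner p \<notin> nodes t' \<longrightarrow> (\<exists>y\<in>nodes t'. \<exists>q\<in>nodes t'. parent t' y = Some q \<and>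
       parent t (Inner p) = Some q \<and> parent t y = Some (Inner p) \<and>
       (\<forall>x\<in>nodes t'. x \<noteq> y \<longrightarrow> parent t x = parent t' x))"
    by (rule grows_tree[OF g])
  let ?v = "Inner p" and ?N = "insert (Inner p) (nodes t')"
  have run: "plp_remove ?i ?v (?v \<notin> nodes t') t s = ((), s', n)"
    using st sh p(1) by (auto simp: plp_method_def Let_def)
  have ich: "Leaf ?i \<in> children t ?v" using p by (simp add: children_def)
  have inv: "plp_inv (nodes t) (parent t) (prim s) (plp s) (inv_plp s)"
    using I by (simp add: plp_invariant_iff)
  have N: "nodes t - {Leaf ?i} = ?N" using p by auto
  have T0: "rooted_tree (nodes t) (parent t)" using ok by (rule rooted_tree_nodes)
  have T: "rooted_tree ?N (parent t)"
    using rooted_tree_remove_leaf[OF T0, of ?i] by (simp only: N)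
  show ?thesis
  proof (rule other_child_cases[OF ich, of s])
    fix m assume oc: "other_child ?v (Leaf ?i) t s = (None, s, m)" and one: "children t ?v = {Leaf ?i}"
    have nt: "nodes t' = {root}" using grows_only_child[OF g p(1) one] by auto
    have "s' = s" using run oc by (auto simp: plp_remove_def prog_defs)
    moreover have "\<not> prim s root" using I by (simp add: plp_invariant_def)
    ultimately show ?thesis
      unfolding plp_invariant_iff by (intro plp_invI) (auto simp: nt)
  next
    fix y m assume oc: "other_child ?v (Leaf ?i) t s = (Some y, s, m)"
      and y: "y \<in> children t ?v" "y \<noteq> Leaf ?i"
    then have y': "y \<in> ?N" "parent t y = Some ?v" using p(3) by (auto simp: children_def)
    define P where "P = (if prim s (Leaf ?i) then (prim s)(y := True) else prim s)"
    define L where "L = (if prim s (Leaf ?i) then (plp s)(inv_plp s ?i := plp s y) else plp s)"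
    define V where "V = (if prim s (Leaf ?i) then (inv_plp s)(plp s y := inv_plp s ?i) else inv_plp s)"
    \<comment> \<open>Only the leaf is detached here. This may leave \<open>?v\<close> with a single
      child, in which case the merge below removes \<open>?v\<close> too.\<close>
    have inv1: "plp_inv ?N (parent t) P L V"
      unfolding P_def L_def V_def N[symmetric]
      using p(1,3) y' y(2) by (intro plp_inv_detach_leaf[OF T0 inv, where v = ?v]) auto
    show ?thesis
    proof (cases "?v \<in> nodes t'")
      case True
      then have N: "?N = nodes t'" by auto
      have "prim s' = P" "plp s' = L" "inv_plp s' = V"
        unfolding P_def L_def V_def using run oc True
        by (auto simp: plp_remove_def set_plp_def prog_defs split: if_splits)
      moreover have "plp_inv (nodes t') (parent t') P L V"
        using inv1 plp_inv_cong[of "nodes t'" "parent t" "parent t'"] old True N by simp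
      ultimately show ?thesis unfolding plp_invariant_iff by simp
    next
      case False
      then obtain y0 q where y0: "y0 \<in> nodes t'" "q \<in> nodes t'" "parent t' y0 = Some q"
        "parent t ?v = Some q" "parent t y0 = Some ?v"
        and rest: "\<And>x. x \<in> nodes t' \<Longrightarrow> x \<noteq> y0 \<Longrightarrow> parent t x = parent t' x"
        using new by blast
      have yu: "x = y0" if "x \<in> ?N" "parent t x = Some ?v" for x
        using split_children[OF ok' False y0(2,4) rest that] by blast
      have y: "y = y0" using yu y' by blast
      have N': "?N - {?v} = nodes t'" using False by auto
      have "plp_inv (?N - {?v}) (parent t') (P(y := P ?v))
          (if P ?v then L else L(y := L ?v)) (if P ?v then V else V(L ?v := y))"
      proof (rule plp_inv_merge_edges[OF T inv1 refl])
        show "?v \<noteq> root" using False by auto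
        show "y \<in> ?N" "parent t y = Some ?v" using y' .
        show "x = y" if "x \<in> ?N" "parent t x = Some ?v" for x using yu that y by blast
        show "parent t ?v = Some q" "parent t' y = Some q" using y0 y by auto
        show "parent t' x = parent t x" if "x \<in> ?N" "x \<noteq> ?v" "x \<noteq> y" for x
          using that rest[of x] y by auto
      qed simp
      moreover have "prim s' = P(y := P ?v)" "plp s' = (if P ?v then L else L(y := L ?v))"
        "inv_plp s' = (if P ?v then V else V(L ?v := y))"
        unfolding P_def L_def V_def using run oc False
        by (auto simp: plp_remove_def inherit_def set_plp_def prog_defs split: if_splits)
      ultimately show ?thesis unfolding plp_invariant_iff by (simp only: N')
    qed
  qed
qed

lemma plp_shorten_invariant:
  assumes ok: "sst_ok t" and I: "plp_invariant t s"
    and st: "leaf_step plp_method Deletion t s t' s' n" and sh: "shortens t"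
  shows "plp_invariant t' s'"
proof -
  let ?i = "start t" and ?k = "act t"
  note sl = shorten_leaf_tree[OF ok st sh]
  obtain v where run: "plp_shorten ?i ?k v t s = ((), s', n)"
    using st sh by (auto simp: plp_method_def Let_def)
  have "prim s' = (prim s)(Leaf ?k := prim s (Leaf ?i))"
    "plp s' = (if prim s (Leaf ?i) then (plp s)(inv_plp s ?i := ?k) else (plp s)(Leaf ?k := ?k))"
    "inv_plp s' = (if prim s (Leaf ?i) then (inv_plp s)(?k := inv_plp s ?i) else (inv_plp s)(?k := Leaf ?k))"
    using run by (auto simp: plp_shorten_def set_plp_def prog_defs split: if_splits)
  then show ?thesis
    using plp_inv_rename_leaf[OF rooted_tree_nodes[OF ok] _ sl(1,2,4,5)] I sl(3)
    unfolding plp_invariant_iff by simp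
qed

lemma reachable_plp_invariant:
  assumes "reachable plp_method \<Sigma> t s"
  shows "plp_invariant t s"
  using assms
proof induction
  case init
  then show ?case
    unfolding plp_invariant_iff
    by (intro plp_invI) (auto simp: nodes_def leaf_words_def plp_method_def)
next
  case (append t s c)
  note tr = append_symbol_tree[OF reachable_ok[OF append.hyps(1)], where c = c]
  have "plp_inv (nodes t) (parent (append_symbol c t)) (prim s) (plp s) (inv_plp s)"
    using append.IH plp_inv_cong[of "nodes t" "parent (append_symbol c t)" "parent t"] tr(2)
    unfolding plp_invariant_iff by blast
  then show ?case
    unfolding plp_invariant_iff tr(1) .
next
  case (leaf t s op t' s' n)
  note ok = reachable_ok[OF leaf.hyps(1)]
  show ?case
  proof (cases op)
    case Insertion
    show ?thesis
      using leaf.hyps(2) unfolding Insertion by (rule plp_insert_invariant[OF ok leaf.IH])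
  next
    case Deletion
    note st = leaf.hyps(2)[unfolded Deletion]
    show ?thesis
      by (cases "shortens t")
        (rule plp_shorten_invariant[OF ok leaf.IH st] plp_remove_invariant[OF ok leaf.IH st], assumption)+
  qed
qed

section \<open>Running time of the primary-leaf-pointer programs\<close>

lemma other_child_time: "other_child v x t s = (w, s', n) \<Longrightarrow> n \<le> 3 \<and> s' = s"
  by (auto simp: other_child_def prog_defs split: if_splits)

text \<open>No program contains a loop or recursion. The longest run, a removal with promotion and
  merging, takes at most 14 steps, so 20 is a generous bound.\<close>

lemma plp_time:
  assumes "leaf_step plp_method op t s t' s' n"
  shows "n \<le> 20"
proof (cases op)
  case Insertion
  then show ?thesis
    using assms
    by (auto simp: plp_method_def Let_def plp_insert_def inherit_def set_plp_def prog_defs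
        split: prod.splits option.splits if_splits dest!: other_child_time)
next
  case Deletion
  then show ?thesis
    using assms
    by (auto simp: plp_method_def Let_def plp_remove_def plp_shorten_def inherit_def set_plp_def prog_defs
        split: prod.splits option.splits if_splits dest!: other_child_time)
qed


section \<open>The credit-based method: upper bound\<close>

definition credit_touch :: "'a node \<Rightarrow> nat \<Rightarrow> 'a credit_store \<Rightarrow> 'a credit_store" where
  "credit_touch x k s =
     s\<lparr>lp := (lp s)(x := max (lp s x) k), cred := (cred s)(x := \<not> cred s x)\<rparr>"

lemma update_None: "update None k t s = ((), s, 0)"
  by (subst update.simps) (simp add: prog_defs)

text \<open>Two reads and two writes give 4; climbing adds the access to the parent and a second
  reading of \<open>lp\<close>, which already sees the maximum.\<close>

lemma update_Some:
  "update (Some x) k t s =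
     (if cred s x then
        (case update (parent t x) (max (lp s x) k) t (credit_touch x k s) of (u, s', n) \<Rightarrow> (u, s', n + 6))
      else ((), credit_touch x k s, 4))"
proof -
  have "cred_update (\<lambda>f. f(x := c)) (lp_update (\<lambda>f. f(x := max (lp s x) k)) s) = credit_touch x k s"
    if "c = (\<not> cred s x)" for c
    using that by (cases s) (simp add: credit_touch_def)
  moreover have "lp (credit_touch x k s) x = max (lp s x) k"
    by (simp add: credit_touch_def)
  ultimately show ?thesis
    by (subst update.simps) (simp add: prog_defs split: prod.splits)
qed

abbreviation time :: "'x \<times> 's \<times> nat \<Rightarrow> nat" where
  "time r \<equiv> snd (snd r)"

lemma update_Some_time:
  "time (update (Some x) k t s) =
     (if cred s x then time (update (parent t x) (max (lp s x) k) t (credit_touch x k s)) + 6 else 4)"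
  by (simp add: update_Some split: prod.splits)

text \<open>Labels get strictly shorter on the way up, so at most
  \<open>Suc (length (label t x))\<close> nodes are visited, at 6 steps each.\<close>

lemma update_time:
  "time (update v k t s) \<le> (case v of None \<Rightarrow> 0 | Some x \<Rightarrow> 6 * Suc (length (label t x)))"
proof (cases v)
  case None
  then show ?thesis by (simp add: update_None)
next
  case (Some x)
  have "time (update (Some x) k t s) \<le> 6 * Suc (length (label t x))"
  proof (induction "length (label t x)" arbitrary: x k s rule: less_induct)
    case less
    show ?case
    proof (cases "parent t x")
      case None
      then show ?thesis by (simp add: update_Some_time update_None)
    next
      case (Some y)
      then have "length (label t y) < length (label t x)" by (rule length_label_parent)
      then have "time (update (Some y) (max (lp s x) k) t (credit_touch x k s)) + 6 \<le>
          6 * Suc (length (label t x))"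
        using less[of y "max (lp s x) k" "credit_touch x k s"] by simp
      then show ?thesis using Some by (simp add: update_Some_time)
    qed
  qed
  then show ?thesis using Some by simp
qed

lemma ex_parent: "label t x \<noteq> [] \<Longrightarrow> \<exists>y. parent t x = Some y"
  by (simp add: parent_def)

lemma parent_label_length:
  assumes "parent t x = Some y" "length (label t x) \<le> l"
  shows "length (label t y) \<le> l"
  using length_label_parent[OF assms(1)] assms(2) by simp

text \<open>The 8 consists of 6 steps for one more level than the label length and 2 for
  initializing a new node.\<close>

lemma credit_insert_time: "time (credit_insert k v b t s) \<le> 6 * length (label t v) + 8"
proof -
  let ?s = "if b then cred_update (\<lambda>f. f(v := False)) (lp_update (\<lambda>f. f(v := k)) s) else s"
  have "time (credit_insert k v b t s) \<le> time (update (Some v) k t ?s) + 2"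
    by (simp add: credit_insert_def prog_defs split: prod.splits)
  also have "\<dots> \<le> 6 * length (label t v) + 8"
    using update_time[of "Some v" k t ?s] by simp
  finally show ?thesis .
qed

lemma credit_shorten_time: "time (credit_shorten i k v t s) \<le> 6 * length (label t v) + 8"
  using update_time[of "Some v" k t s] by (simp add: credit_shorten_def)

text \<open>The update starts one level higher, at the parent of \<open>v\<close>, which pays for
  finding that parent.\<close>

lemma credit_remove_time: "time (credit_remove i v b t s) \<le> 6 * length (label t v) + 8"
proof -
  have "time (update (parent t v) l t s) \<le> 6 * length (label t v)" for l
    using update_time[of "parent t v" l t s] length_label_parent[of t v]
    by (cases "parent t v") (auto intro: order.trans)
  then show ?thesis
    by (auto simp: credit_remove_def prog_defs split: prod.splits) (metis snd_conv le_SucI add.commute add_le_mono1 le_add2 order.trans)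
qed

lemma credit_time:
  assumes ok: "sst_ok t" and st: "leaf_step credit_method op t s t' s' n"
  shows "n \<le> 6 * length (window t) + 8"
proof (cases op)
  case Insertion
  let ?v = "the (parent t' (Leaf (act t)))"
  have st': "pending t" "t' = insert_leaf t"
    "credit_insert (act t) ?v (?v \<notin> nodes t) t' s = ((), s', n)"
    using st Insertion by (auto simp: credit_method_def Let_def)
  have lab: "label t' (Leaf (act t)) = drop (act t) (input t)"
    using st'(2) by (simp add: insert_leaf_def)
  have len: "length (drop (act t) (input t)) \<le> length (window t)"
    using ok by (auto simp: window_def sst_ok_def)
  have "drop (act t) (input t) \<noteq> []" using st'(1) by (simp add: pending_def)
  then obtain v where v: "parent t' (Leaf (act t)) = Some v"
    using ex_parent[of t' "Leaf (act t)"] unfolding lab by blast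
  then have "length (label t' ?v) \<le> length (window t)"
    using parent_label_length[OF v, unfolded lab, OF len] v by simp
  then show ?thesis
    using credit_insert_time[of "act t" ?v "?v \<notin> nodes t" t' s] st'(3) by simp
next
  case Deletion
  let ?v = "the (parent t (Leaf (start t)))"
  have ne: "window t \<noteq> []" using st Deletion by simp
  then obtain v where "parent t (Leaf (start t)) = Some v"
    using ex_parent[of t "Leaf (start t)"] by (auto simp: window_def)
  then have len: "length (label t ?v) \<le> length (window t)"
    using parent_label_length[of t "Leaf (start t)" v] by (simp add: window_def)
  show ?thesis
  proof (cases "shortens t")
    case True
    then have "credit_shorten (start t) (act t) ?v t s = ((), s', n)"
      using st Deletion by (auto simp: credit_method_def Let_def)
    then show ?thesis using credit_shorten_time[of "start t" "act t" ?v t s] len by simp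
  next
    case False
    then have "credit_remove (start t) ?v (?v \<notin> nodes t') t s = ((), s', n)"
      using st Deletion by (auto simp: credit_method_def Let_def)
    then show ?thesis using credit_remove_time[of "start t" ?v "?v \<notin> nodes t'" t s] len by simp
  qed
qed

lemma op_times_credit: "n \<in> op_times credit_method \<Sigma> ops w \<Longrightarrow> n \<le> 6 * w + 8"
  using credit_time reachable_ok unfolding op_times_def by fastforce

lemma bdd_above_op_times_credit: "bdd_above (op_times credit_method \<Sigma> ops w)"
  using op_times_credit by (intro bdd_aboveI[of _ "6 * w + 8"]) blast

lemma worst_time_credit_le: "worst_time credit_method \<Sigma> ops w \<le> 6 * w + 8"
proof (cases "op_times credit_method \<Sigma> ops w = {}")
  case True
  \<comment> \<open>On \<open>nat\<close>, the supremum of the empty set is 0.\<close>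
  then show ?thesis by (simp add: worst_time_def)
next
  case False
  then show ?thesis
    unfolding worst_time_def by (rule cSup_least) (rule op_times_credit)
qed

text \<open>The threshold 5 is where the insertion example first has a nonempty run
  \<open>a^j\<close> with \<open>j = (w - 3) div 2\<close>.\<close>

lemma worst_time_credit_bigtheta:
  assumes "\<And>w. w \<ge> 5 \<Longrightarrow> \<exists>n \<in> op_times (credit_method :: ('a, 'a credit_store) lp_method) \<Sigma> ops w. w \<le> n"
  shows "(\<lambda>w. real (worst_time (credit_method :: ('a, 'a credit_store) lp_method) \<Sigma> ops w))
    \<in> \<Theta>(\<lambda>w. real w)"
proof (intro bigthetaI bigoI landau_omega.bigI)
  let ?f = "\<lambda>w. worst_time (credit_method :: ('a, 'a credit_store) lp_method) \<Sigma> ops w"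
  \<comment> \<open>The factor comes from \<open>6 * w + 8 \<le> 14 * w\<close> for
    \<open>w \<ge> 1\<close>.\<close>
  show "\<forall>\<^sub>F w in at_top. norm (real (?f w)) \<le> 14 * norm (real w)"
    using eventually_ge_at_top[of 1]
  proof eventually_elim
    case (elim w)
    then have "?f w \<le> 14 * w" using worst_time_credit_le[of \<Sigma> ops w] by linarith
    then show ?case by (simp flip: of_nat_mult of_nat_le_iff)
  qed
  show "\<forall>\<^sub>F w in at_top. norm (real (?f w)) \<ge> 1 * norm (real w)"
    using eventually_ge_at_top[of 5]
  proof eventually_elim
    case (elim w)
    then obtain n where n: "n \<in> op_times (credit_method :: ('a, 'a credit_store) lp_method) \<Sigma> ops w" "w \<le> n"
      using assms by blast
    then have "n \<le> ?f w"
      unfolding worst_time_def by (intro cSup_upper bdd_above_op_times_credit)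
    then show ?case using n(2) by simp
  qed
qed simp

section \<open>The credit-based method: lower bound\<close>

text \<open>A visited node flips only its own bit, so the bits above it are still 1 when the climb
  reaches them. The 6 steps are counted only for the \<open>j\<close> nodes below the root.\<close>

lemma update_chain_time:
  assumes "\<And>i. 1 \<le> i \<Longrightarrow> i \<le> j \<Longrightarrow> cred s (Inner (replicate i a))"
    and "\<And>i. i < j \<Longrightarrow> parent t (Inner (replicate (Suc i) a)) = Some (Inner (replicate i a))"
  shows "6 * j \<le> time (update (Some (Inner (replicate j a))) k t s)"
  using assms
proof (induction j arbitrary: k s)
  case 0
  show ?case by simp
next
  case (Suc j)
  let ?x = "Inner (replicate (Suc j) a)"
  let ?s = "credit_touch ?x k s"
  \<comment> \<open>Touching the lowest node of the chain leaves the bits of the others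
    unchanged.\<close>
  have ne: "replicate i a \<noteq> replicate (Suc j) a" if "i \<le> j" for i
    using that by (metis length_replicate not_less_eq_eq order_refl)
  have "6 * j \<le> time (update (Some (Inner (replicate j a))) (max (lp s ?x) k) t ?s)"
    using Suc.prems ne by (intro Suc.IH) (auto simp: credit_touch_def simp del: replicate_Suc)
  moreover have "cred s ?x" using Suc.prems(1)[of "Suc j"] by simp
  moreover have "parent t ?x = Some (Inner (replicate j a))" using Suc.prems(2)[of j] by simp
  ultimately show ?case by (simp add: update_Some_time del: replicate_Suc)
qed

section \<open>Leaves and inner nodes of the text \<open>a^m b zs\<close>\<close>

lemma prefix_replicate_snoc:
  assumes "a \<noteq> b"
  shows "prefix (replicate i a @ [x]) (replicate l a @ b # zs) \<longleftrightarrow> x = a \<and> i < l \<or> x = b \<and> i = l"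
  using assms
proof (induction i arbitrary: l)
  case 0
  then show ?case by (cases l) auto
next
  case (Suc i)
  then show ?case by (cases l) auto
qed

text \<open>\<open>q\<close> is the number of leaves created so far. The tail \<open>zs\<close> is
  empty while the credits are built up and for the deletion, and becomes a prefix of
  \<open>a^j c\<close> for the insertion.\<close>

definition run_text :: "'a \<Rightarrow> 'a \<Rightarrow> nat \<Rightarrow> 'a list \<Rightarrow> nat \<Rightarrow> 'a sst" where
  "run_text a b m zs q = \<lparr>input = replicate m a @ b # zs, start = 0, act = q\<rparr>"

lemma drop_run_text:
  assumes "j \<le> m"
  shows "drop j (input (run_text a b m zs q)) = replicate (m - j) a @ b # zs"
  using assms by (simp add: run_text_def)

lemma leaf_words_run_text:
  assumes "q \<le> Suc m"
  shows "leaf_words (run_text a b m zs q) = {replicate l a @ b # zs |l. l \<le> m \<and> m < l + q}"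
proof -
  have "leaf_words (run_text a b m zs q) = (\<lambda>j. replicate (m - j) a @ b # zs) ` {0..<q}"
    unfolding leaf_words_def using assms
    by (intro image_cong) (auto simp: run_text_def)
  also have "\<dots> = {replicate l a @ b # zs |l. l \<le> m \<and> m < l + q}"
  proof (intro equalityI subsetI)
    fix w assume "w \<in> {replicate l a @ b # zs |l. l \<le> m \<and> m < l + q}"
    then obtain l where "w = replicate l a @ b # zs" "l \<le> m" "m < l + q" by blast
    then show "w \<in> (\<lambda>j. replicate (m - j) a @ b # zs) ` {0..<q}"
      by (intro image_eqI[of _ _ "m - l"]) auto
  qed (use assms in fastforce)
  finally show ?thesis .
qed

text \<open>The first leaf, present since \<open>1 \<le> q\<close>, provides all continuations by
  \<open>a\<close>; the one by \<open>b\<close> after \<open>a^i\<close> needs the leaf at position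
  \<open>m - i\<close>.\<close>

lemma run_trie_snoc:
  assumes "a \<noteq> b" "q \<le> Suc m" "1 \<le> q"
  shows "replicate i a @ [x] \<in> trie_words (leaf_words (run_text a b m zs q)) \<longleftrightarrow>
    x = a \<and> i < m \<or> x = b \<and> i \<le> m \<and> m < i + q"
proof -
  have "replicate i a @ [x] \<in> trie_words (leaf_words (run_text a b m zs q)) \<longleftrightarrow>
    (\<exists>l. l \<le> m \<and> m < l + q \<and> prefix (replicate i a @ [x]) (replicate l a @ b # zs))"
    unfolding trie_words_def leaf_words_run_text[OF assms(2)] by blast
  also have "\<dots> \<longleftrightarrow> (\<exists>l. l \<le> m \<and> m < l + q \<and> (x = a \<and> i < l \<or> x = b \<and> i = l))"
    by (simp only: prefix_replicate_snoc[OF assms(1)])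
  also have "\<dots> \<longleftrightarrow> x = a \<and> i < m \<or> x = b \<and> i \<le> m \<and> m < i + q"
    using assms by auto
  finally show ?thesis .
qed

text \<open>For \<open>a^i\<close> to branch, both \<open>a\<close> and \<open>b\<close> must follow
  it; \<open>i = 0\<close> is left out because the root is always inner.\<close>

lemma run_inner:
  assumes "a \<noteq> b" "q \<le> Suc m" "1 \<le> q" "1 \<le> i"
  shows "replicate i a \<in> ctrie_inner (leaf_words (run_text a b m zs q)) \<longleftrightarrow> i < m \<and> m < i + q"
  using assms by (auto simp: ctrie_inner_def run_trie_snoc) blast

lemma leaf_step_Insertion:
  assumes "pending t"
  shows "\<exists>s' n. leaf_step M Insertion t s (insert_leaf t) s' n"
  using assms by (auto simp: Let_def) (metis old.unit.exhaust prod_cases3)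

text \<open>Every suffix of \<open>a^m\<close> is a prefix of it, so only the first symbol creates a
  leaf and \<open>act\<close> stays 1.\<close>

lemma reachable_replicate:
  assumes "a \<in> \<Sigma>" "1 \<le> m"
  shows "\<exists>s. reachable credit_method \<Sigma> \<lparr>input = replicate m a, start = 0, act = 1\<rparr> s"
  using assms(2)
proof (induction m rule: dec_induct)
  case base
  let ?t = "append_symbol a \<lparr>input = [], start = 0, act = 0\<rparr>"
  have t: "reachable credit_method \<Sigma> ?t (init_store credit_method)"
    using assms(1) by (intro reachable.append reachable.init) (auto simp: pending_def)
  have "pending ?t"
    by (simp add: pending_def append_symbol_def leaf_words_def trie_words_def)
  then obtain s' n where "leaf_step credit_method Insertion ?t (init_store credit_method) (insert_leaf ?t) s' n"
    using leaf_step_Insertion[of ?t credit_method "init_store credit_method"] by blast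
  with t have "reachable credit_method \<Sigma> (insert_leaf ?t) s'" by (rule reachable.leaf)
  then show ?case by (auto simp: insert_leaf_def append_symbol_def)
next
  case (step m)
  let ?t = "\<lparr>input = replicate m a, start = 0, act = 1\<rparr>"
  obtain s where s: "reachable credit_method \<Sigma> ?t s" using step.IH by blast
  have "prefix (replicate (m - 1) a) (replicate m a)"
    using step.hyps(1) by (cases m) (auto simp: replicate_append_same[symmetric])
  then have "\<not> pending ?t"
    by (auto simp: pending_def active_suffix_def leaf_words_def trie_words_def)
  with s have "reachable credit_method \<Sigma> (append_symbol a ?t) s"
    using assms(1) by (rule reachable.append)
  then show ?case by (auto simp: append_symbol_def replicate_append_same)
qed

text \<open>\<open>Leaf q\<close> branches off at \<open>a^(m-q)\<close>. For \<open>q < m\<close>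
  this node is created with the leaf: its bit starts at 0, and the update sets it to 1 and stops
  there, so the bits of deeper nodes survive. For \<open>q = m\<close> the leaf hangs at the root,
  and only the bit of the root flips.\<close>

lemma reachable_run:
  assumes ab: "a \<noteq> b" "a \<in> \<Sigma>" "b \<in> \<Sigma>" and q: "1 \<le> q" "q \<le> Suc m" and m: "1 \<le> m"
  shows "\<exists>s. reachable credit_method \<Sigma> (run_text a b m [] q) s \<and>
    (\<forall>i. 1 \<le> i \<and> i < m \<and> m < i + q \<longrightarrow> cred s (Inner (replicate i a)))"
  using q
proof (induction q rule: dec_induct)
  case base
  let ?t = "\<lparr>input = replicate m a, start = 0, act = 1\<rparr>"
  obtain s where s: "reachable credit_method \<Sigma> ?t s"
    using reachable_replicate[OF ab(2) m] by blast
  have "prefix (replicate (m - 1) a) (replicate m a)"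
    using m by (cases m) (auto simp: replicate_append_same[symmetric])
  then have "\<not> pending ?t"
    by (auto simp: pending_def active_suffix_def leaf_words_def trie_words_def)
  with s have "reachable credit_method \<Sigma> (append_symbol b ?t) s"
    using ab(3) by (rule reachable.append)
  \<comment> \<open>For \<open>q = 1\<close> no \<open>i < m\<close> satisfies
    \<open>m < i + q\<close>, so nothing is claimed about credits.\<close>
  then show ?case by (auto simp: append_symbol_def run_text_def)
next
  case (step q)
  let ?t = "run_text a b m [] q" and ?t' = "run_text a b m [] (Suc q)"
  let ?u = "replicate (m - q) a"
  let ?v = "Inner ?u"
  obtain s where s: "reachable credit_method \<Sigma> ?t s"
    and cr: "\<And>i. 1 \<le> i \<Longrightarrow> i < m \<Longrightarrow> m < i + q \<Longrightarrow> cred s (Inner (replicate i a))"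
    using step by auto
  have q: "1 \<le> q" "q \<le> m" using step by auto
  have act: "active_suffix ?t = ?u @ [b]"
    using q drop_run_text[of q m a b "[]" q] by (simp add: active_suffix_def run_text_def)
  have "?u @ [b] \<notin> trie_words (leaf_words ?t)"
    using run_trie_snoc[of a b q m "m - q" b "[]"] ab q by auto
  then have p: "pending ?t"
    using act q by (simp add: pending_def) (simp add: run_text_def)
  have t': "insert_leaf ?t = ?t'" "act ?t = q" by (auto simp: insert_leaf_def run_text_def)
  obtain s' n where st: "leaf_step credit_method Insertion ?t s ?t' s' n"
    using leaf_step_Insertion[OF p] t' by metis
  have "?u \<in> ctrie_inner (leaf_words ?t')"
    using run_inner[of a b "Suc q" m "m - q" "[]"] ab q by (cases "q = m") auto
  then have pa: "parent ?t' (Leaf q) = Some ?v"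
    using drop_run_text[of q m a b "[]" "Suc q"] q by (intro parent_snoc[where c = b]) auto
  have run: "credit_insert q ?v (?v \<notin> nodes ?t) ?t' s = ((), s', n)"
    using st pa t' by (auto simp: credit_method_def Let_def)
  have "cred s' (Inner (replicate i a))" if i: "1 \<le> i" "i < m" "m < i + Suc q" for i
  proof (cases "q = m")
    case True
    then have "cred s (Inner (replicate i a))" using cr i by simp
    moreover have "cred s' = (cred s)(root := \<not> cred s root)"
      using run True
      by (auto simp: credit_insert_def prog_defs update_Some update_None credit_touch_def split: if_splits)
    moreover have "Inner (replicate i a) \<noteq> root" using i by auto
    ultimately show ?thesis by simp
  next
    case False
    then have "?v \<notin> nodes ?t"
      using run_inner[of a b q m "m - q" "[]"] ab q by (auto simp: Inner_in_nodes)
    then have "cred s' = (cred s)(?v := True)"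
      using run by (auto simp: credit_insert_def prog_defs update_Some credit_touch_def)
    then show ?thesis using cr i by (cases "i = m - q") auto
  qed
  moreover have "reachable credit_method \<Sigma> ?t' s'" using s st by (rule reachable.leaf)
  ultimately show ?case by blast
qed

lemma run_parent:
  assumes "a \<noteq> b" "Suc i < m"
  shows "parent (run_text a b m zs (Suc m)) (Inner (replicate (Suc i) a)) = Some (Inner (replicate i a))"
proof -
  have "replicate i a \<in> ctrie_inner (leaf_words (run_text a b m zs (Suc m)))"
    using run_inner[of a b "Suc m" m i zs] assms by (cases "i = 0") auto
  from parent_Inner_snoc[OF this, of a] show ?thesis
    by (simp add: replicate_append_same)
qed

text \<open>Without the leaf of the whole window \<open>a^m b\<close>, the node
  \<open>a^(m-1)\<close> continues only with \<open>b\<close> and is merged away. Its credit starts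
  an update at \<open>a^(m-2)\<close>, which climbs over the \<open>m - 2\<close> nodes below the
  root, all with credit 1.\<close>

lemma credit_deletion_slow:
  assumes ab: "a \<noteq> b" "a \<in> \<Sigma>" "b \<in> \<Sigma>" and m: "2 \<le> m"
  shows "\<exists>n \<in> op_times credit_method \<Sigma> {Deletion} (Suc m). 6 * (m - 2) \<le> n"
proof -
  let ?t = "run_text a b m [] (Suc m)" and ?v = "Inner (replicate (m - 1) a)"
  let ?t' = "remove_leaf ?t"
  obtain s where s: "reachable credit_method \<Sigma> ?t s"
    and cr: "\<And>i. 1 \<le> i \<Longrightarrow> i < m \<Longrightarrow> cred s (Inner (replicate i a))"
    using reachable_run[OF ab, of "Suc m" m] m by auto
  have lab: "label ?t (Leaf 0) = replicate m a @ [b]" by (simp add: run_text_def)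
  have "replicate (m - 1) a \<in> ctrie_inner (leaf_words ?t)"
    using run_inner[of a b "Suc m" m "m - 1" "[]"] ab m by auto
  moreover have "strict_prefix (replicate (m - 1) a) (replicate m a @ [b])"
    using m by (cases m) (auto simp: strict_prefix_def replicate_append_same[symmetric])
  moreover have "prefix v (replicate (m - 1) a)"
    if v: "v \<in> ctrie_inner (leaf_words ?t)" "strict_prefix v (replicate m a @ [b])" for v
  proof -
    have "prefix v (replicate m a)" using v(2) by (auto simp: strict_prefix_def)
    then obtain i where i: "v = replicate i a" "i \<le> m"
      by (metis append_eq_append_conv_if append_take_drop_id prefix_def take_replicate prefix_length_le length_replicate append_eq_conv_conj min.absorb1)
    then have "i \<le> m - 1"
      using run_inner[of a b "Suc m" m i "[]"] ab v(1) m by (cases "i = 0") auto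
    then show ?thesis unfolding i by (metis le_add_diff_inverse prefixI replicate_add)
  qed
  ultimately have pa: "parent ?t (Leaf 0) = Some ?v"
    unfolding lab[symmetric] by (rule parent_eqI)
  \<comment> \<open>Only the suffix at position 0 starts with \<open>m\<close> copies of
    \<open>a\<close>.\<close>
  have "replicate (m - 1) a @ [a] \<notin> trie_words (leaf_words ?t')"
  proof
    assume "replicate (m - 1) a @ [a] \<in> trie_words (leaf_words ?t')"
    then obtain j where j: "1 \<le> j" "j \<le> m" "prefix (replicate (m - 1) a @ [a]) (drop j (input ?t))"
      by (auto simp: trie_words_def leaf_words_def remove_leaf_def run_text_def)
    then show False
      using prefix_replicate_snoc[OF ab(1), of "m - 1" a "m - j" "[]"] drop_run_text[OF j(2), of a b "[]"] ab(1)
      by simp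
  qed
  moreover have "\<exists>c. c \<noteq> b \<and> replicate (m - 1) a @ [c] \<in> trie_words (leaf_words ?t')"
    if "replicate (m - 1) a \<in> ctrie_inner (leaf_words ?t')"
    using that m unfolding ctrie_inner_def by auto metis
  moreover have "c = b \<or> c = a" if "replicate (m - 1) a @ [c] \<in> trie_words (leaf_words ?t')" for c
  proof -
    have "leaf_words ?t' \<subseteq> leaf_words ?t" by (auto simp: leaf_words_def remove_leaf_def)
    then have "replicate (m - 1) a @ [c] \<in> trie_words (leaf_words ?t)"
      using that by (auto simp: trie_words_def)
    then show ?thesis using run_trie_snoc[of a b "Suc m" m] ab by auto
  qed
  ultimately have merged: "?v \<notin> nodes ?t'" by (auto simp: Inner_in_nodes)
  have start: "start ?t = 0" "act ?t = Suc m" "length (window ?t) = Suc m"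
    by (auto simp: run_text_def window_def)
  have as: "active_suffix ?t = []" by (simp add: active_suffix_def run_text_def)
  then have np: "\<not> pending ?t" by (auto simp: pending_def run_text_def)
  have ns: "\<not> shortens ?t" using as by (simp add: shortens_def)
  obtain s' n where run: "credit_remove 0 ?v True ?t s = ((), s', n)"
    by (metis old.unit.exhaust prod_cases3)
  have step: "leaf_step credit_method Deletion ?t s ?t' s' n"
    using np ns start pa merged run by (auto simp: Let_def credit_method_def)
  have m2: "m - 1 = Suc (m - 2)" using m by simp
  have "6 * (m - 2) \<le> time (update (Some (Inner (replicate (m - 2) a))) k ?t s)" for k
    using m by (intro update_chain_time cr run_parent ab) auto
  moreover have "parent ?t ?v = Some (Inner (replicate (m - 2) a))"
    unfolding m2 using m by (intro run_parent ab) auto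
  moreover have "cred s ?v" using m by (intro cr) auto
  ultimately have "6 * (m - 2) \<le> time (credit_remove 0 ?v True ?t s)"
    by (simp add: credit_remove_def prog_defs split: prod.splits) (metis le_SucI snd_conv)
  then have "6 * (m - 2) \<le> n" using run by simp
  then show ?thesis
    using s step start unfolding op_times_def by blast
qed

text \<open>For \<open>j \<le> m\<close> the active suffix \<open>a^j\<close> is a prefix of the
  window, so no leaf is created and all credits in the store are kept.\<close>

lemma reachable_run_append:
  assumes s: "reachable credit_method \<Sigma> (run_text a b m [] (Suc m)) s" and a: "a \<in> \<Sigma>" and j: "j \<le> m"
  shows "reachable credit_method \<Sigma> (run_text a b m (replicate j a) (Suc m)) s
    \<and> \<not> pending (run_text a b m (replicate j a) (Suc m))"
  using j
proof (induction j)
  case 0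
  then show ?case using s by (simp add: pending_def run_text_def)
next
  case (Suc j)
  let ?t = "run_text a b m (replicate j a) (Suc m)" and ?t' = "run_text a b m (replicate (Suc j) a) (Suc m)"
  have "append_symbol a ?t = ?t'"
    by (simp add: append_symbol_def run_text_def replicate_append_same)
  then have "reachable credit_method \<Sigma> ?t' s"
    using reachable.append[of credit_method \<Sigma> ?t s a] Suc a by auto
  moreover have "active_suffix ?t' = replicate (Suc j) a"
    by (simp add: active_suffix_def run_text_def)
  moreover have "replicate (Suc j) a \<in> trie_words (leaf_words ?t')"
  proof -
    have "prefix (replicate (Suc j) a) (replicate m a @ b # replicate (Suc j) a)"
      using Suc.prems by (metis append_assoc le_add_diff_inverse prefixI replicate_add)
    then show ?thesis
      using leaf_words_run_text[of "Suc m" m a b "replicate (Suc j) a"]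
      unfolding trie_words_def by (auto simp del: replicate_Suc)
  qed
  ultimately show ?case by (simp add: pending_def del: replicate_Suc)
qed

text \<open>As \<open>j < m\<close>, the node \<open>a^j\<close> exists, with continuations
  \<open>a\<close> and \<open>b\<close>; the third symbol \<open>c\<close> adds a leaf there without
  splitting an edge. The update then meets credit 1 at all of \<open>a^j, ..., a\<close>. The window
  consists of \<open>m + 1\<close> symbols for \<open>a^m b\<close> and \<open>j + 1\<close> for
  \<open>a^j c\<close>.\<close>

lemma credit_insertion_slow:
  assumes ab: "distinct [a, b, c]" "a \<in> \<Sigma>" "b \<in> \<Sigma>" "c \<in> \<Sigma>" and j: "j < m" "1 \<le> j"
  shows "\<exists>n \<in> op_times credit_method \<Sigma> {Insertion} (m + j + 2). 6 * j \<le> n"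
proof -
  let ?r = "run_text a b m (replicate j a) (Suc m)"
  let ?t = "run_text a b m (replicate j a @ [c]) (Suc m)" and ?v = "Inner (replicate j a)"
  let ?t' = "insert_leaf ?t"
  have neq: "a \<noteq> b" "a \<noteq> c" "b \<noteq> c" using ab by auto
  obtain s where s: "reachable credit_method \<Sigma> (run_text a b m [] (Suc m)) s"
    and cr: "\<And>i. 1 \<le> i \<Longrightarrow> i < m \<Longrightarrow> cred s (Inner (replicate i a))"
    using reachable_run[OF neq(1) ab(2,3), of "Suc m" m] j by auto
  have "append_symbol c ?r = ?t" by (simp add: append_symbol_def run_text_def)
  then have t: "reachable credit_method \<Sigma> ?t s"
    using reachable.append[of credit_method \<Sigma> ?r s c] reachable_run_append[OF s ab(2)] j ab(4) by auto
  have as: "active_suffix ?t = replicate j a @ [c]"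
    by (simp add: active_suffix_def run_text_def)
  have "replicate j a @ [c] \<notin> trie_words (leaf_words ?t)"
    using run_trie_snoc[of a b "Suc m" m j c] neq by auto
  then have p: "pending ?t" using as by (simp add: pending_def) (simp add: run_text_def)
  obtain s' n where step: "leaf_step credit_method Insertion ?t s ?t' s' n"
    using leaf_step_Insertion[OF p, of credit_method s] by blast
  \<comment> \<open>Inserting the leaf keeps all inner nodes, so the chain of the nodes
    \<open>a^i\<close> found before the insertion is still there when the update runs.\<close>
  have mono: "ctrie_inner (leaf_words ?t) \<subseteq> ctrie_inner (leaf_words ?t')"
    by (intro ctrie_inner_mono) (auto simp: leaf_words_def insert_leaf_def)
  have inner: "replicate i a \<in> ctrie_inner (leaf_words ?t)" if "i < m" for i
    using run_inner[of a b "Suc m" m i] neq that by (cases "i = 0") auto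
  have pa: "parent ?t' (Leaf (Suc m)) = Some ?v"
    using inner[of j] mono j by (intro parent_snoc[where c = c]) (auto simp: insert_leaf_def run_text_def)
  have "?v \<in> nodes ?t" using inner j by (simp add: Inner_in_nodes)
  moreover have "act ?t = Suc m" by (simp add: run_text_def)
  ultimately have run: "credit_insert (Suc m) ?v False ?t' s = ((), s', n)"
    using step pa by (auto simp: Let_def credit_method_def)
  have chain: "parent ?t' (Inner (replicate (Suc i) a)) = Some (Inner (replicate i a))" if "i < j" for i
    using parent_Inner_snoc[of "replicate i a" ?t' a] inner[of i] mono that j
    by (auto simp: replicate_append_same)
  have "6 * j \<le> time (update (Some ?v) (Suc m) ?t' s)"
    using j by (intro update_chain_time cr chain) auto
  then have "6 * j \<le> n"
    using run by (auto simp: credit_insert_def prog_defs split: prod.splits)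
  moreover have "length (window ?t) = m + j + 2" by (simp add: window_def run_text_def)
  ultimately show ?thesis
    using t step unfolding op_times_def by blast
qed

lemma op_times_mono: "A \<subseteq> B \<Longrightarrow> op_times M \<Sigma> A w \<subseteq> op_times M \<Sigma> B w"
  unfolding op_times_def by blast

text \<open>Leaving \<open>ops\<close> open lets the deletion example serve both for deletions alone
  and for all operations together.\<close>

lemma credit_deletion_bigtheta:
  assumes "a \<in> \<Sigma>" "b \<in> \<Sigma>" "a \<noteq> b" "Deletion \<in> ops"
  shows "(\<lambda>w. real (worst_time (credit_method :: ('a, 'a credit_store) lp_method) \<Sigma> ops w))
    \<in> \<Theta>(\<lambda>w. real w)"
proof (rule worst_time_credit_bigtheta)
  fix w :: nat assume w: "5 \<le> w"
  have "\<exists>n \<in> op_times credit_method \<Sigma> {Deletion} (Suc (w - 1)). 6 * (w - 1 - 2) \<le> n"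
    using assms w by (intro credit_deletion_slow[of a b]) auto
  moreover have "Suc (w - 1) = w" "w - 1 - 2 = w - 3" using w by auto
  ultimately obtain n where "n \<in> op_times credit_method \<Sigma> {Deletion} w" "6 * (w - 3) \<le> n"
    by auto
  moreover have "op_times credit_method \<Sigma> {Deletion} w \<subseteq> op_times credit_method \<Sigma> ops w"
    using assms(4) by (intro op_times_mono) simp
  moreover have "w \<le> 6 * (w - 3)" using w by simp
  ultimately show "\<exists>n \<in> op_times credit_method \<Sigma> ops w. w \<le> n"
    by (meson order.trans subsetD)
qed

lemma credit_insertion_bigtheta:
  assumes "a \<in> \<Sigma>" "b \<in> \<Sigma>" "c \<in> \<Sigma>" "distinct [a, b, c]"
  shows "(\<lambda>w. real (worst_time (credit_method :: ('a, 'a credit_store) lp_method) \<Sigma> {Insertion} w))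
    \<in> \<Theta>(\<lambda>w. real w)"
proof (rule worst_time_credit_bigtheta)
  fix w :: nat assume w: "5 \<le> w"
  \<comment> \<open>With \<open>m = w - 2 - j\<close> the window length \<open>m + j + 2\<close> is
    exactly \<open>w\<close>, and \<open>j\<close> is as large as \<open>j < m\<close>
    permits.\<close>
  define j where "j = (w - 3) div 2"
  have "w - 3 \<le> 2 * j + 1" "2 * j \<le> w - 3" unfolding j_def by linarith+
  then have "1 \<le> j" "j < w - 2 - j" using w by linarith+
  \<comment> \<open>From \<open>w \<le> 2 * j + 4\<close> and \<open>1 \<le> j\<close>.\<close>
  moreover from this have "w \<le> 6 * j" using \<open>w - 3 \<le> 2 * j + 1\<close> by linarith
  ultimately have j: "1 \<le> j" "j < w - 2 - j" "w \<le> 6 * j" by blast+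
  have "w - 2 - j + j + 2 = w" using j by simp
  then obtain n where "n \<in> op_times credit_method \<Sigma> {Insertion} w" "6 * j \<le> n"
    using credit_insertion_slow[OF assms(4,1-3) j(2,1)] by metis
  then show "\<exists>n \<in> op_times credit_method \<Sigma> {Insertion} w. w \<le> n"
    using j(3) order.trans by blast
qed

text \<open>The boundedness clause gives the suprema in \<open>worst_time\<close> their meaning, and
  the clause on \<open>plp_invariant\<close> ensures that the constant-time programs really maintain
  the pointers. The alphabet conditions supply the symbols of the slow examples.\<close>

theorem theorem3:
  fixes \<Sigma> :: "'a set"
  shows
    "((\<exists>a\<in>\<Sigma>. \<exists>b\<in>\<Sigma>. a \<noteq> b) \<longrightarrow>
        (\<forall>w. bdd_above (op_times (credit_method :: ('a, 'a credit_store) lp_method)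
                          \<Sigma> {Insertion, Deletion} w)) \<and>
        (\<lambda>w. real (worst_time (credit_method :: ('a, 'a credit_store) lp_method)
                     \<Sigma> {Insertion, Deletion} w)) \<in> \<Theta>(\<lambda>w. real w)) \<and>
     ((\<exists>a\<in>\<Sigma>. \<exists>b\<in>\<Sigma>. \<exists>c\<in>\<Sigma>. distinct [a, b, c]) \<longrightarrow>
        (\<forall>op. (\<lambda>w. real (worst_time (credit_method :: ('a, 'a credit_store) lp_method)
                     \<Sigma> {op} w)) \<in> \<Theta>(\<lambda>w. real w))) \<and>
     (\<exists>C. \<forall>w. \<forall>n \<in> op_times (plp_method :: ('a, 'a plp_store) lp_method)
                      \<Sigma> {Insertion, Deletion} w. n \<le> C) \<and>
     (\<forall>t s. reachable (plp_method :: ('a, 'a plp_store) lp_method) \<Sigma> t s \<longrightarrow> plp_invariant t s)"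
proof (intro conjI impI allI)
  assume "\<exists>a\<in>\<Sigma>. \<exists>b\<in>\<Sigma>. a \<noteq> b"
  then obtain a b where ab: "a \<in> \<Sigma>" "b \<in> \<Sigma>" "a \<noteq> b" by blast
  show "bdd_above (op_times (credit_method :: ('a, 'a credit_store) lp_method) \<Sigma> {Insertion, Deletion} w)" for w
    by (rule bdd_above_op_times_credit)
  show "(\<lambda>w. real (worst_time (credit_method :: ('a, 'a credit_store) lp_method)
    \<Sigma> {Insertion, Deletion} w)) \<in> \<Theta>(\<lambda>w. real w)"
    using ab by (rule credit_deletion_bigtheta) simp
next
  fix op
  assume "\<exists>a\<in>\<Sigma>. \<exists>b\<in>\<Sigma>. \<exists>c\<in>\<Sigma>. distinct [a, b, c]"
  then obtain a b c where abc: "a \<in> \<Sigma>" "b \<in> \<Sigma>" "c \<in> \<Sigma>" "distinct [a, b, c]" by blast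
  show "(\<lambda>w. real (worst_time (credit_method :: ('a, 'a credit_store) lp_method) \<Sigma> {op} w))
    \<in> \<Theta>(\<lambda>w. real w)"
  proof (cases op)
    case Insertion
    then show ?thesis using credit_insertion_bigtheta[OF abc] by simp
  next
    case Deletion
    then show ?thesis using credit_deletion_bigtheta[of a \<Sigma> b "{Deletion}"] abc by simp
  qed
next
  show "\<exists>C. \<forall>w. \<forall>n \<in> op_times (plp_method :: ('a, 'a plp_store) lp_method)
    \<Sigma> {Insertion, Deletion} w. n \<le> C"
    unfolding op_times_def by (blast intro: plp_time)
next
  fix t s assume "reachable (plp_method :: ('a, 'a plp_store) lp_method) \<Sigma> t s"
  then show "plp_invariant t s" by (rule reachable_plp_invariant)
qed

end
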